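(* Let $A$ be a non-negative $d\times d$ matrix. The selected leading eigenvector of $A$ is proportional to the limit of the power method applied to the matrix $A$ with the initial vector $\boldsymbol{x}_0=\boldsymbol{e}$, where $\boldsymbol{e}=(1,\ldots,1)^T\in\mathbb{R}^d$ is the vector of ones.
   Context: For a non-negative matrix $A$, $\rho(A)$ is its spectral radius. It equals the maximal non-negative eigenvalue of $A$, called the leading eigenvalue, and a corresponding non-negative (non-zero) eigenvector is called a leading eigenvector; it may be non-unique even up to scaling. Normalized means $\|\boldsymbol{v}\|=1$ in the Euclidean norm. Selected leading eigenvector: for $\varepsilon>0$ let $A_\varepsilon=A+\varepsilon E$, where $E=\boldsymbol{e}\boldsymbol{e}^T$ is the matrix of ones, and let $\boldsymbol{v}_\varepsilon$ be the normalized leading eigenvector of $A_\varepsilon$. The selected leading eigenvector of $A$ is the limit $\lim_{\varepsilon\to0}\boldsymbol{v}_\varepsilon$. Power method: $\boldsymbol{x}_{k+1}=A\boldsymbol{x}_k$, $k\ge0$; its convergence to a leading eigenvector is understood up to normalization. If there are several eigenvalues of largest modulus, convergence is understood for the averaged sequence $\frac1r\sum_{j=0}^{r-1}\boldsymbol{x}_{k+j}$, where $r$ is the imprimitivity index of $A$ (for irreducible $A$, the number of eigenvalues of modulus $\rho(A)$). In all cases one says that the power method converges. For the sake of simplicity it is assumed that there is only one eigenvalue of largest modulus, maybe multiple, i.e., that $r=1$.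
   Formalization: The claim about the power method is made only when the spectral radius of A is positive: for nilpotent A (e.g. A = 0) the iterates vanish and have no limit up to normalization; existence of the selected leading eigenvector is still proved in that case. *)

theory Defs
  imports "Jordan_Normal_Form.Spectral_Radius"
begin

definition nonneg_matrix :: "real mat \<Rightarrow> bool" where
  "nonneg_matrix A \<longleftrightarrow> (\<forall>i < dim_row A. \<forall>j < dim_col A. 0 \<le> A $$ (i, j))"

text \<open>The library's \<open>spectral_radius\<close> ranges over complex eigenvalues, so a real matrix is
  embedded into the complex matrices first.\<close>

definition cplx_mat :: "real mat \<Rightarrow> complex mat" where
  "cplx_mat A = map_mat complex_of_real A"

definition \<rho> :: "real mat \<Rightarrow> real" where
  "\<rho> A = spectral_radius (cplx_mat A)"

definition leading_eigenvector :: "real mat \<Rightarrow> real vec \<Rightarrow> bool" where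
  "leading_eigenvector A v \<longleftrightarrow> eigenvector A v (\<rho> A) \<and> 0\<^sub>v (dim_row A) \<le> v"

definition euclid_norm :: "real vec \<Rightarrow> real" where
  "euclid_norm v = sqrt (v \<bullet> v)"

definition normalize_vec :: "real vec \<Rightarrow> real vec" where
  "normalize_vec v = inverse (euclid_norm v) \<cdot>\<^sub>v v"

text \<open>The type of vectors carries no topology (it contains vectors of all dimensions).
  Convergence in a fixed finite dimension is convergence of the coordinates.\<close>

definition vec_tendsto :: "('a \<Rightarrow> real vec) \<Rightarrow> real vec \<Rightarrow> 'a filter \<Rightarrow> bool" where
  "vec_tendsto f v F \<longleftrightarrow>
     (\<forall>\<^sub>F x in F. dim_vec (f x) = dim_vec v) \<and>
     (\<forall>i < dim_vec v. ((\<lambda>x. f x $ i) \<longlongrightarrow> v $ i) F)"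

definition ones_vec :: "nat \<Rightarrow> real vec" where
  "ones_vec d = vec d (\<lambda>_. 1)"

definition ones_mat :: "nat \<Rightarrow> real mat" where
  "ones_mat d = mat d d (\<lambda>_. 1)"

definition perturbed :: "real mat \<Rightarrow> real \<Rightarrow> real mat" where
  "perturbed A \<epsilon> = A + \<epsilon> \<cdot>\<^sub>m ones_mat (dim_row A)"

text \<open>For \<open>\<epsilon> > 0\<close> the matrix \<open>perturbed A \<epsilon>\<close> is positive, so that the normalized leading
  eigenvector below exists and is unique by the Perron theorem.\<close>

definition perturbed_eigenvector :: "real mat \<Rightarrow> real \<Rightarrow> real vec" where
  "perturbed_eigenvector A \<epsilon> =
     (THE v. leading_eigenvector (perturbed A \<epsilon>) v \<and> euclid_norm v = 1)"

definition selected_leading_eigenvector :: "real mat \<Rightarrow> real vec \<Rightarrow> bool" where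
  "selected_leading_eigenvector A v \<longleftrightarrow>
     v \<in> carrier_vec (dim_row A) \<and> vec_tendsto (perturbed_eigenvector A) v (at_right 0)"

primrec power_method :: "real mat \<Rightarrow> real vec \<Rightarrow> nat \<Rightarrow> real vec" where
  "power_method A x 0 = x"
| "power_method A x (Suc k) = A *\<^sub>v power_method A x k"

text \<open>Convergence up to normalization: the limit \<open>w\<close> matters only up to a positive factor. No
  averaging over consecutive iterates is involved, so this is the notion appropriate to matrices
  with a single eigenvalue of largest modulus.\<close>

definition power_method_converges_to :: "real mat \<Rightarrow> real vec \<Rightarrow> real vec \<Rightarrow> bool" where
  "power_method_converges_to A x w \<longleftrightarrow>
     leading_eigenvector A w \<and>
     (\<forall>k. power_method A x k \<noteq> 0\<^sub>v (dim_row A)) \<and>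
     vec_tendsto (\<lambda>k. normalize_vec (power_method A x k)) (normalize_vec w) sequentially"

text \<open>The eigenvalue may be multiple, algebraically or geometrically: eigenvalues are counted here
  as elements of the spectrum.\<close>

definition unique_peripheral_eigenvalue :: "real mat \<Rightarrow> bool" where
  "unique_peripheral_eigenvalue A \<longleftrightarrow>
     (\<exists>!l. l \<in> spectrum (cplx_mat A) \<and> cmod l = \<rho> A)"

end

theory Submission
  imports Defs
begin

text \<open>Both limits in the theorem are governed by the sequence \<open>A\<^sup>k e\<close> of row sums of the powers of
  \<open>A\<close>, and they are linked by an Abelian theorem.

  The equation \<open>(A + \<epsilon> e e\<^sup>T) v = l v\<close> says that \<open>(l I - A) v = \<epsilon> (e\<^sup>T v) e\<close>. For
  \<open>l > \<rho> A\<close> this means that \<open>v\<close> is proportional to \<open>(l I - A)\<^sup>-\<^sup>1 e\<close>, that is, to the power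
  series \<open>F(l) = \<Sum>k. l\<^sup>-\<^sup>k A\<^sup>k e\<close>, and that \<open>l\<close> solves the scalar equation
  \<open>l = \<epsilon> e\<^sup>T F(l)\<close>. That equation has a solution \<open>l > \<rho> A\<close>
  (\<open>secular_equation_solvable\<close>). The vector \<open>F(l)\<close> is positive, so by a
  Perron argument this \<open>l\<close> is the spectral radius of the perturbed matrix and the normalization of
  \<open>F(l)\<close> is its only normalized leading eigenvector (\<open>perturbed_eigenvector_eq\<close>). As \<open>\<epsilon>\<close>
  decreases to 0, \<open>l\<close> tends to \<open>\<rho> A\<close> from above. Hence the selected leading eigenvector is the limiting
  direction of \<open>F(l)\<close> as \<open>l\<close> decreases to \<open>\<rho> A\<close>.

  Suppose \<open>\<rho> A > 0\<close>. By the Jordan normal form, the entries of \<open>A\<^sup>k e\<close> are combinations of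
  the sequences \<open>(k choose t) \<mu>\<^sup>k\<^sup>-\<^sup>t\<close> with \<open>\<mu>\<close> an eigenvalue. As only one eigenvalue has largest
  modulus, \<open>A\<^sup>k e\<close> is asymptotic to \<open>\<rho> A\<^sup>k k\<^sup>m c\<close> for some \<open>m\<close> and some non-zero vector
  \<open>c \<ge> 0\<close> (\<open>row_sum_leading_term\<close>). The power method therefore converges to the
  direction of \<open>c\<close>, and \<open>A c = \<rho> A c\<close>. Since \<open>\<Sum>k. k\<^sup>m x\<^sup>k\<close> diverges as \<open>x\<close> increases to 1,
  the power series \<open>F(l)\<close> inherits the direction of its coefficients
  (\<open>abel_quotient_tendsto\<close>), and the two limits agree.

  If \<open>\<rho> A = 0\<close>, then \<open>A\<close> is nilpotent, \<open>F(l)\<close> is a finite sum, and its limiting direction is that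
  of the last non-zero \<open>A\<^sup>k e\<close>.\<close>

section \<open>Entries of matrix powers\<close>

lemma jordan_matrix_pow_entry_induct:
  fixes n_as :: "(nat \<times> 'a :: comm_ring_1) list" and S :: "(nat \<Rightarrow> 'a) \<Rightarrow> bool"
  assumes zero: "S (\<lambda>_. 0)"
    and basic: "\<And>n \<mu> t. (n, \<mu>) \<in> set n_as \<Longrightarrow> n > 0 \<Longrightarrow> S (\<lambda>k. of_nat (k choose t) * \<mu> ^ (k - t))"
    and "i < sum_list (map fst n_as)" "j < sum_list (map fst n_as)"
  shows "S (\<lambda>k. (jordan_matrix n_as ^\<^sub>m k) $$ (i, j))"
  using assms
proof (induction n_as arbitrary: i j)
  case Nil
  then show ?case by simp
next
  case (Cons na n_as)
  obtain n \<mu> where na: "na = (n, \<mu>)" by force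
  let ?N = "sum_list (map fst n_as)"
  let ?D = "\<lambda>k. diag_block_mat (map (\<lambda>(n, a). jordan_block n a ^\<^sub>m k) n_as)"
  have dim: "dim_row (?D k) = ?N" "dim_col (?D k) = ?N" for k
    unfolding jordan_matrix_pow[symmetric]
    using pow_carrier_mat[OF jordan_matrix_carrier[of n_as], of k] by auto
  have step: "(jordan_matrix (na # n_as) ^\<^sub>m k) $$ (i, j) =
      (if i < n then if j < n then (jordan_block n \<mu> ^\<^sub>m k) $$ (i, j) else 0
       else if j < n then 0 else (jordan_matrix n_as ^\<^sub>m k) $$ (i - n, j - n))" for k
    unfolding jordan_matrix_pow using Cons.prems(3,4) dim[of k]
    by (auto simp: na Let_def index_mat_four_block)
  consider (block) "i < n" "j < n" | (off) "i < n \<longleftrightarrow> \<not> j < n" | (rest) "\<not> i < n" "\<not> j < n"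
    by blast
  then show ?case
  proof cases
    case block
    have "(jordan_block n \<mu> ^\<^sub>m k) $$ (i, j) =
        (if i \<le> j then of_nat (k choose (j - i)) * \<mu> ^ (k - (j - i)) else 0)" for k
      unfolding jordan_block_pow using block by auto
    moreover have "S (\<lambda>k. of_nat (k choose (j - i)) * \<mu> ^ (k - (j - i)))"
      using Cons.prems(2)[of n \<mu>] block na by auto
    ultimately show ?thesis
      using block zero unfolding step by (cases "i \<le> j") auto
  next
    case off
    then have "(\<lambda>k. (jordan_matrix (na # n_as) ^\<^sub>m k) $$ (i, j)) = (\<lambda>_. 0)"
      unfolding step by auto
    then show ?thesis using zero by simp
  next
    case rest
    have "S (\<lambda>k. (jordan_matrix n_as ^\<^sub>m k) $$ (i - n, j - n))"
      using Cons.prems rest na by (intro Cons.IH) auto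
    then show ?thesis using rest unfolding step by simp
  qed
qed

text \<open>Everything that is needed from the Jordan normal form: a linear property of sequences holds for the
  entries of \<open>A\<^sup>k\<close> as soon as it holds for the entries of the powers of a Jordan block. It is used
  below for summability, for polynomial asymptotics and for nilpotency.\<close>

lemma matrix_power_entry_induct:
  fixes A :: "complex mat" and S :: "(nat \<Rightarrow> complex) \<Rightarrow> bool"
  assumes A: "A \<in> carrier_mat n n" and i: "i < n" and j: "j < n"
    and zero: "S (\<lambda>_. 0)"
    and add: "\<And>f g. S f \<Longrightarrow> S g \<Longrightarrow> S (\<lambda>k. f k + g k)"
    and scale: "\<And>c f. S f \<Longrightarrow> S (\<lambda>k. c * f k)"
    and basic: "\<And>\<mu> t. \<mu> \<in> spectrum A \<Longrightarrow> S (\<lambda>k. of_nat (k choose t) * \<mu> ^ (k - t))"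
  shows "S (\<lambda>k. (A ^\<^sub>m k) $$ (i, j))"
proof -
  obtain n_as where jnf: "jordan_nf A n_as"
    using char_poly_factorized[OF A] jordan_nf_exists[OF A] by blast
  obtain P Q where P: "P \<in> carrier_mat n n" and Q: "Q \<in> carrier_mat n n"
    and cp: "char_poly A = (\<Prod>(na, a)\<leftarrow>n_as. [:- a, 1:] ^ na)"
    and pow: "\<And>k. A ^\<^sub>m k = P * jordan_matrix n_as ^\<^sub>m k * Q"
    by (rule jordan_nf_powE[OF A jnf]) blast
  have N: "sum_list (map fst n_as) = n"
  proof -
    have "similar_mat A (jordan_matrix n_as)" using jnf unfolding jordan_nf_def by blast
    then obtain m where "{A, jordan_matrix n_as} \<subseteq> carrier_mat m m"
      using similar_matD by blast
    then show ?thesis using A by (auto dest!: carrier_matD(1))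
  qed
  have J: "jordan_matrix n_as ^\<^sub>m k \<in> carrier_mat n n" for k
    using pow_carrier_mat[OF jordan_matrix_carrier[of n_as], of k] N by simp
  \<comment> \<open>A block of size 0 contributes no factor to the characteristic polynomial, hence \<open>m > 0\<close>.\<close>
  have root: "\<mu> \<in> spectrum A" if "(m, \<mu>) \<in> set n_as" "m > 0" for m \<mu>
  proof -
    have "poly (char_poly A) \<mu> = 0"
      unfolding cp poly_prod_list using that
      by (auto simp: prod_list_zero_iff image_iff power_0_left intro!: bexI[of _ "(m,\<mu>)"])
    then show ?thesis using spectrum_root_char_poly[OF A] by simp
  qed
  have Jentry: "S (\<lambda>k. (jordan_matrix n_as ^\<^sub>m k) $$ (p, q))" if "p < n" "q < n" for p q
    by (rule jordan_matrix_pow_entry_induct[of S])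
       (use that N zero basic root in auto)
  have sum: "S (\<lambda>k. \<Sum>x\<in>X. f x k)" if "finite X" "\<And>x. x \<in> X \<Longrightarrow> S (f x)" for X :: "nat set" and f
    using that by (induction X rule: finite_induct) (auto intro: zero add)
  have mult: "(X * Y) $$ (p, q) = (\<Sum>r\<in>{0..<n}. X $$ (p, r) * Y $$ (r, q))"
    if "X \<in> carrier_mat n n" "Y \<in> carrier_mat n n" "p < n" "q < n" for X Y :: "complex mat" and p q
    using that by (auto simp: scalar_prod_def)
  have "(A ^\<^sub>m k) $$ (i, j) =
      (\<Sum>q\<in>{0..<n}. Q $$ (q, j) * (\<Sum>p\<in>{0..<n}. P $$ (i, p) * (jordan_matrix n_as ^\<^sub>m k) $$ (p, q)))" for k
    unfolding pow mult[OF mult_carrier_mat[OF P J] Q i j]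
    by (intro sum.cong refl) (simp add: mult[OF P J i] mult.commute del: index_mult_mat)
  moreover have "S (\<lambda>k. \<Sum>q\<in>{0..<n}. Q $$ (q, j) * (\<Sum>p\<in>{0..<n}. P $$ (i, p) * (jordan_matrix n_as ^\<^sub>m k) $$ (p, q)))"
    by (intro sum scale Jentry) auto
  ultimately show ?thesis by simp
qed

section \<open>Exponential polynomials\<close>

text \<open>The step from \<open>m\<close> to \<open>m + 1\<close> is termwise differentiation, which preserves convergence inside
  the unit disc.\<close>

lemma summable_nat_power_times_geometric:
  fixes x :: "'a :: {real_normed_field, banach}"
  assumes "norm x < 1"
  shows "summable (\<lambda>k. of_nat k ^ m * x ^ k)"
  using assms
proof (induction m arbitrary: x)
  case 0
  then show ?case by (simp add: summable_geometric)
next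
  case (Suc m)
  have "summable (\<lambda>k. diffs (\<lambda>k. of_nat k ^ m) k * x ^ k)"
    by (rule termdiff_converges[OF Suc.prems]) (rule Suc.IH)
  then have "summable (\<lambda>k. x * (diffs (\<lambda>k. of_nat k ^ m) k * x ^ k))"
    by (rule summable_mult)
  also have "(\<lambda>k. x * (diffs (\<lambda>k. of_nat k ^ m) k * x ^ k)) = (\<lambda>k. of_nat (Suc k) ^ Suc m * x ^ Suc k)"
    by (simp add: diffs_def fun_eq_iff del: of_nat_Suc)
  finally show ?case
    by (subst (asm) summable_Suc_iff)
qed

lemma binomial_exponential_le:
  fixes \<mu> :: complex
  assumes "\<mu> \<noteq> 0"
  shows "norm (of_nat (k choose t) * \<mu> ^ (k - t)) \<le> of_nat k ^ t * norm \<mu> ^ k / norm \<mu> ^ t"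
proof (cases "t \<le> k")
  case True
  have "real (k choose t) \<le> of_nat k ^ t"
    using binomial_le_pow[OF True] by (metis of_nat_le_iff of_nat_power)
  moreover have "norm \<mu> ^ (k - t) = norm \<mu> ^ k / norm \<mu> ^ t"
    using True assms by (simp add: power_diff)
  ultimately show ?thesis
    by (simp add: norm_mult norm_power mult_right_mono divide_right_mono)
qed (simp add: binomial_eq_0)

lemma binomial_nilpotent_eventually_zero:
  "\<forall>\<^sub>F k in sequentially. of_nat (k choose t) * (0 :: complex) ^ (k - t) = 0"
  using eventually_gt_at_top[of t] by eventually_elim auto

lemma summable_binomial_exponential:
  fixes \<mu> :: complex
  assumes "norm \<mu> < r"
  shows "summable (\<lambda>k. norm (of_nat (k choose t) * \<mu> ^ (k - t)) / r ^ k)"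
proof (cases "\<mu> = 0")
  case True
  have "\<forall>\<^sub>F k in sequentially. norm (of_nat (k choose t) * \<mu> ^ (k - t)) / r ^ k = 0"
    using binomial_nilpotent_eventually_zero[of t] unfolding True by eventually_elim auto
  then show ?thesis
    by (subst summable_cong[where g = "\<lambda>_. 0"]) auto
next
  case False
  have r: "r > 0" using assms norm_ge_zero[of \<mu>] by linarith
  have "summable (\<lambda>k. inverse (norm \<mu> ^ t) * (of_nat k ^ t * (norm \<mu> / r) ^ k))"
    using assms r by (intro summable_mult summable_nat_power_times_geometric) auto
  then show ?thesis
  proof (rule summable_comparison_test')
    fix k
    show "norm (norm (of_nat (k choose t) * \<mu> ^ (k - t)) / r ^ k)
      \<le> inverse (norm \<mu> ^ t) * (of_nat k ^ t * (norm \<mu> / r) ^ k)"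
      using divide_right_mono[OF binomial_exponential_le[OF False, of k t], of "r ^ k"] r
      by (simp add: field_simps)
  qed
qed

lemma binomial_polynomial:
  "\<exists>p :: complex poly. \<forall>k. poly p (of_nat k) = of_nat (k choose t)"
proof (intro exI allI)
  fix k
  show "poly (Polynomial.smult (inverse (fact t)) (\<Prod>i=0..<t. [:- of_nat i, 1:])) (of_nat k :: complex) = of_nat (k choose t)"
    by (simp add: binomial_gbinomial gbinomial_prod_rev poly_prod field_simps)
qed

text \<open>Contributions that are small against \<open>l\<^sup>k\<close> are ignored, so that besides a polynomial multiple of
  \<open>l\<^sup>k\<close> the class contains the sequences that come from smaller eigenvalues and is closed under
  sums and multiples, as \<open>matrix_power_entry_induct\<close> requires.\<close>

definition exp_poly_asymptotics :: "complex \<Rightarrow> (nat \<Rightarrow> complex) \<Rightarrow> bool" where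
  "exp_poly_asymptotics l f \<longleftrightarrow> (\<exists>p. (\<lambda>k. f k / l ^ k - poly p (of_nat k)) \<longlonglongrightarrow> 0)"

lemma exp_poly_asymptotics_zero: "exp_poly_asymptotics l (\<lambda>_. 0)"
  unfolding exp_poly_asymptotics_def by (intro exI[of _ 0]) simp

lemma exp_poly_asymptotics_add:
  assumes "exp_poly_asymptotics l f" "exp_poly_asymptotics l g"
  shows "exp_poly_asymptotics l (\<lambda>k. f k + g k)"
proof -
  obtain p q where "(\<lambda>k. f k / l ^ k - poly p (of_nat k)) \<longlonglongrightarrow> 0"
      "(\<lambda>k. g k / l ^ k - poly q (of_nat k)) \<longlonglongrightarrow> 0"
    using assms unfolding exp_poly_asymptotics_def by blast
  from tendsto_add[OF this] show ?thesis
    unfolding exp_poly_asymptotics_def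
    by (intro exI[of _ "p + q"]) (simp add: algebra_simps add_divide_distrib)
qed

lemma exp_poly_asymptotics_scale:
  assumes "exp_poly_asymptotics l f"
  shows "exp_poly_asymptotics l (\<lambda>k. c * f k)"
proof -
  obtain p where "(\<lambda>k. f k / l ^ k - poly p (of_nat k)) \<longlonglongrightarrow> 0"
    using assms unfolding exp_poly_asymptotics_def by blast
  from tendsto_mult_right_zero[OF this, of c] show ?thesis
    unfolding exp_poly_asymptotics_def
    by (intro exI[of _ "Polynomial.smult c p"]) (simp add: algebra_simps)
qed

lemma exp_poly_asymptotics_dominant:
  assumes "l \<noteq> 0"
  shows "exp_poly_asymptotics l (\<lambda>k. of_nat (k choose t) * l ^ (k - t))"
proof -
  obtain p :: "complex poly" where p: "\<And>k. poly p (of_nat k) = of_nat (k choose t)"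
    using binomial_polynomial[of t] by blast
  have "of_nat (k choose t) * l ^ (k - t) / l ^ k - poly (Polynomial.smult (inverse (l ^ t)) p) (of_nat k) = 0" for k
    using assms by (cases "t \<le> k") (auto simp: p power_diff field_simps binomial_eq_0)
  then show ?thesis
    unfolding exp_poly_asymptotics_def
    by (intro exI[of _ "Polynomial.smult (inverse (l ^ t)) p"]) simp
qed

lemma exp_poly_asymptotics_dominated:
  assumes "norm \<mu> < norm l"
  shows "exp_poly_asymptotics l (\<lambda>k. of_nat (k choose t) * \<mu> ^ (k - t))"
proof -
  have "(\<lambda>k. norm (of_nat (k choose t) * \<mu> ^ (k - t)) / norm l ^ k) \<longlonglongrightarrow> 0"
    by (rule summable_LIMSEQ_zero[OF summable_binomial_exponential[OF assms]])
  then have "(\<lambda>k. of_nat (k choose t) * \<mu> ^ (k - t) / l ^ k) \<longlonglongrightarrow> 0"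
    by (subst tendsto_norm_zero_iff[symmetric]) (simp add: norm_divide norm_power norm_mult)
  then show ?thesis
    unfolding exp_poly_asymptotics_def by (intro exI[of _ 0]) simp
qed

section \<open>Non-negative matrices and the row sums of their powers\<close>

locale nonneg_square_matrix =
  fixes A :: "real mat" and d :: nat
  assumes d: "0 < d" and A: "A \<in> carrier_mat d d" and nonneg: "nonneg_matrix A"
begin

lemma entry_nonneg: "i < d \<Longrightarrow> j < d \<Longrightarrow> 0 \<le> A $$ (i, j)"
  using nonneg A unfolding nonneg_matrix_def by auto

lemma mult_vec_index: "x \<in> carrier_vec d \<Longrightarrow> i < d \<Longrightarrow> (A *\<^sub>v x) $ i = (\<Sum>j<d. A $$ (i, j) * x $ j)"
  using A by (auto simp: scalar_prod_def lessThan_atLeast0 intro!: sum.cong)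

lemma cplx_carrier: "cplx_mat A \<in> carrier_mat d d"
  using A unfolding cplx_mat_def by auto

lemma spectrum_iff:
  "\<mu> \<in> spectrum (cplx_mat A) \<longleftrightarrow>
    (\<exists>x. (\<exists>i<d. x i \<noteq> 0) \<and> (\<forall>i<d. \<mu> * x i = (\<Sum>j<d. of_real (A $$ (i, j)) * x j)))"
proof -
  have mult: "(cplx_mat A *\<^sub>v x) $ i = (\<Sum>j<d. of_real (A $$ (i, j)) * x $ j)"
    if "x \<in> carrier_vec d" "i < d" for x i
    using that A by (auto simp: scalar_prod_def lessThan_atLeast0 cplx_mat_def intro!: sum.cong)
  have dim: "dim_row (cplx_mat A) = d" using cplx_carrier by auto
  show ?thesis
  proof
    assume "\<mu> \<in> spectrum (cplx_mat A)"
    then obtain v where v: "v \<in> carrier_vec d" "v \<noteq> 0\<^sub>v d" "cplx_mat A *\<^sub>v v = \<mu> \<cdot>\<^sub>v v"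
      unfolding spectrum_def eigenvalue_def eigenvector_def dim by auto
    have "\<exists>i<d. v $ i \<noteq> 0" using v(1,2) by (auto intro: eq_vecI)
    moreover have "\<mu> * v $ i = (\<Sum>j<d. of_real (A $$ (i, j)) * v $ j)" if "i < d" for i
      using mult[OF v(1) that] v that by simp
    ultimately show "\<exists>x. (\<exists>i<d. x i \<noteq> 0) \<and> (\<forall>i<d. \<mu> * x i = (\<Sum>j<d. of_real (A $$ (i, j)) * x j))"
      by (intro exI[of _ "\<lambda>i. v $ i"]) auto
  next
    assume "\<exists>x. (\<exists>i<d. x i \<noteq> 0) \<and> (\<forall>i<d. \<mu> * x i = (\<Sum>j<d. of_real (A $$ (i, j)) * x j))"
    then obtain x i where x: "i < d" "x i \<noteq> 0" "\<forall>i<d. \<mu> * x i = (\<Sum>j<d. of_real (A $$ (i, j)) * x j)"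
      by blast
    have "vec d x \<noteq> 0\<^sub>v d"
    proof
      assume "vec d x = 0\<^sub>v d"
      then have "vec d x $ i = 0\<^sub>v d $ i" by simp
      then show False using x by simp
    qed
    moreover have "cplx_mat A *\<^sub>v vec d x = \<mu> \<cdot>\<^sub>v vec d x"
    proof (rule eq_vecI)
      fix i assume "i < dim_vec (\<mu> \<cdot>\<^sub>v vec d x)"
      then show "(cplx_mat A *\<^sub>v vec d x) $ i = (\<mu> \<cdot>\<^sub>v vec d x) $ i"
        using x(3) mult[of "vec d x" i] by simp
    qed (use dim in auto)
    ultimately show "\<mu> \<in> spectrum (cplx_mat A)"
      unfolding spectrum_def eigenvalue_def eigenvector_def dim
      by (auto intro!: exI[of _ "vec d x"])
  qed
qed

lemma spectrum_le_rho: "\<mu> \<in> spectrum (cplx_mat A) \<Longrightarrow> cmod \<mu> \<le> \<rho> A"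
  unfolding \<rho>_def using spectral_radius_mem_max(2)[OF cplx_carrier d] by blast

lemma rho_attained: obtains \<mu> where "\<mu> \<in> spectrum (cplx_mat A)" "cmod \<mu> = \<rho> A"
  using spectral_radius_mem_max(1)[OF cplx_carrier d] unfolding \<rho>_def by auto

lemma rho_nonneg: "0 \<le> \<rho> A"
  using rho_attained by (metis norm_ge_zero)

text \<open>The eigenvalue of a positive eigenvector \<open>f\<close> is the spectral radius: in the maximum norm
  weighted by \<open>1 / f\<close> the matrix has operator norm \<open>l\<close>. In the proof,
  \<open>t\<close> is that norm of an eigenvector \<open>x\<close> of a peripheral eigenvalue.\<close>

lemma rho_eq_of_positive_eigenvector:
  assumes pos: "\<And>i. i < d \<Longrightarrow> 0 < f i"
    and eig: "\<And>i. i < d \<Longrightarrow> (\<Sum>j<d. A $$ (i, j) * f j) = l * f i"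
  shows "\<rho> A = l"
proof (rule antisym)
  obtain \<mu> where \<mu>: "\<mu> \<in> spectrum (cplx_mat A)" "cmod \<mu> = \<rho> A" by (rule rho_attained)
  obtain x i0 where i0: "i0 < d" "x i0 \<noteq> 0"
    and x: "\<And>i. i < d \<Longrightarrow> \<mu> * x i = (\<Sum>j<d. of_real (A $$ (i, j)) * x j)"
    using \<mu>(1) unfolding spectrum_iff by blast
  define t where "t = Max ((\<lambda>i. cmod (x i) / f i) ` {..<d})"
  have fin: "finite ((\<lambda>i. cmod (x i) / f i) ` {..<d})" by simp
  have le: "cmod (x i) \<le> t * f i" if "i < d" for i
  proof -
    have "cmod (x i) / f i \<le> t" unfolding t_def using that by (intro Max_ge[OF fin]) auto
    then show ?thesis using pos[OF that] by (simp add: pos_divide_le_eq)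
  qed
  have "t \<in> (\<lambda>i. cmod (x i) / f i) ` {..<d}"
    unfolding t_def using d by (intro Max_in[OF fin]) (auto simp: lessThan_empty_iff)
  then obtain i where i: "i < d" "cmod (x i) / f i = t" by auto
  have xi: "cmod (x i) = t * f i" using i pos[OF i(1)] by (simp add: field_simps)
  have "0 < t * f i0" using le[OF i0(1)] i0(2) by (metis less_le_trans zero_less_norm_iff)
  then have t: "0 < t" using pos[OF i0(1)] by (simp add: zero_less_mult_iff)
  have "cmod \<mu> * (t * f i) = cmod (\<Sum>j<d. of_real (A $$ (i, j)) * x j)"
    using x[OF i(1)] xi by (metis norm_mult)
  also have "\<dots> \<le> (\<Sum>j<d. A $$ (i, j) * (t * f j))"
    by (intro sum_norm_le) (auto simp: norm_mult entry_nonneg i(1) intro!: mult_left_mono le)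
  also have "\<dots> = t * (\<Sum>j<d. A $$ (i, j) * f j)"
    by (simp add: sum_distrib_left mult_ac)
  also have "\<dots> = l * (t * f i)" using eig[OF i(1)] by simp
  finally show "\<rho> A \<le> l" using t pos[OF i(1)] \<mu>(2) by simp
next
  have "0 \<le> l * f 0"
    unfolding eig[OF d, symmetric]
    by (intro sum_nonneg mult_nonneg_nonneg) (auto simp: entry_nonneg d less_imp_le[OF pos])
  then have l: "0 \<le> l" using pos[OF d] by (simp add: zero_le_mult_iff)
  have "complex_of_real l \<in> spectrum (cplx_mat A)"
    unfolding spectrum_iff
  proof (intro exI[of _ "\<lambda>i. complex_of_real (f i)"] conjI allI impI)
    show "\<exists>i<d. complex_of_real (f i) \<noteq> 0" using d pos[OF d] by force
    fix i assume "i < d"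
    from arg_cong[OF eig[OF this], of complex_of_real]
    show "complex_of_real l * complex_of_real (f i) = (\<Sum>j<d. complex_of_real (A $$ (i, j)) * complex_of_real (f j))"
      by simp
  qed
  from spectrum_le_rho[OF this] l show "l \<le> \<rho> A" by simp
qed

lemma eigenvector_iff:
  "eigenvector A v l \<longleftrightarrow>
    v \<in> carrier_vec d \<and> (\<exists>i<d. v $ i \<noteq> 0) \<and> (\<forall>i<d. (\<Sum>j<d. A $$ (i, j) * v $ j) = l * v $ i)"
proof -
  have dim: "dim_row A = d" using A by auto
  have "(v \<noteq> 0\<^sub>v d) \<longleftrightarrow> (\<exists>i<d. v $ i \<noteq> 0)" if "v \<in> carrier_vec d"
    using that by (auto intro: eq_vecI)
  moreover have "A *\<^sub>v v = l \<cdot>\<^sub>v v \<longleftrightarrow> (\<forall>i<d. (\<Sum>j<d. A $$ (i, j) * v $ j) = l * v $ i)"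
    if "v \<in> carrier_vec d"
  proof -
    have "A *\<^sub>v v = l \<cdot>\<^sub>v v \<longleftrightarrow> (\<forall>i<d. (A *\<^sub>v v) $ i = (l \<cdot>\<^sub>v v) $ i)"
    proof
      assume "\<forall>i<d. (A *\<^sub>v v) $ i = (l \<cdot>\<^sub>v v) $ i"
      then show "A *\<^sub>v v = l \<cdot>\<^sub>v v"
        using that dim by (intro eq_vecI) auto
    qed simp
    then show ?thesis using that mult_vec_index[OF that] by auto
  qed
  ultimately show ?thesis unfolding eigenvector_def dim by auto
qed

text \<open>Subtract from \<open>g\<close> the largest multiple of \<open>f\<close> that keeps the difference non-negative. The
  difference has a zero entry, and a positive matrix turns every non-zero non-negative vector into a
  positive one.\<close>

lemma nonneg_eigenvector_unique:
  assumes Apos: "\<And>i j. i < d \<Longrightarrow> j < d \<Longrightarrow> 0 < A $$ (i, j)"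
    and pos: "\<And>i. i < d \<Longrightarrow> 0 < f i"
    and f: "\<And>i. i < d \<Longrightarrow> (\<Sum>j<d. A $$ (i, j) * f j) = l * f i"
    and g: "\<And>i. i < d \<Longrightarrow> (\<Sum>j<d. A $$ (i, j) * g j) = l * g i"
  shows "\<exists>t. \<forall>i<d. g i = t * f i"
proof -
  define t where "t = Min ((\<lambda>i. g i / f i) ` {..<d})"
  have fin: "finite ((\<lambda>i. g i / f i) ` {..<d})" by simp
  have le: "0 \<le> g i - t * f i" if "i < d" for i
  proof -
    have "t \<le> g i / f i" unfolding t_def using that by (intro Min_le[OF fin]) auto
    then show ?thesis using pos[OF that] by (simp add: pos_le_divide_eq)
  qed
  have "t \<in> (\<lambda>i. g i / f i) ` {..<d}"
    unfolding t_def using d by (intro Min_in[OF fin]) (auto simp: lessThan_empty_iff)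
  then obtain i where i: "i < d" "g i / f i = t" by auto
  have gi: "g i - t * f i = 0" using i pos[OF i(1)] by (simp add: field_simps)
  have "(\<Sum>j<d. A $$ (i, j) * (g j - t * f j)) = l * g i - t * (l * f i)"
    unfolding f[OF i(1), symmetric] g[OF i(1), symmetric]
    by (simp add: algebra_simps sum_subtractf sum_distrib_left)
  also have "\<dots> = l * (g i - t * f i)" by (simp add: algebra_simps)
  finally have "(\<Sum>j<d. A $$ (i, j) * (g j - t * f j)) = 0" using gi by simp
  then have "A $$ (i, j) * (g j - t * f j) = 0" if "j < d" for j
    by (subst (asm) sum_nonneg_eq_0_iff) (use that le entry_nonneg i in auto)
  then have "g j = t * f j" if "j < d" for j using that Apos[OF i(1) that] by force
  then show ?thesis by blast
qed

text \<open>Entry \<open>i\<close> of \<open>A\<^sup>k e\<close> is the sum of row \<open>i\<close> of \<open>A\<^sup>k\<close>. The iterates are handled as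
  functions of two indices, so that analysis takes place on real sequences and the dimensions of
  vectors do not enter.\<close>

definition row_sum :: "nat \<Rightarrow> nat \<Rightarrow> real" where
  "row_sum k i = power_method A (ones_vec d) k $ i"

lemma power_method_carrier: "power_method A (ones_vec d) k \<in> carrier_vec d"
  using A by (induction k) (auto simp: ones_vec_def)

lemma row_sum_0: "i < d \<Longrightarrow> row_sum 0 i = 1"
  unfolding row_sum_def by (simp add: ones_vec_def)

lemma row_sum_Suc: "i < d \<Longrightarrow> row_sum (Suc k) i = (\<Sum>j<d. A $$ (i, j) * row_sum k j)"
  unfolding row_sum_def using mult_vec_index[OF power_method_carrier, of i k] by simp

lemma row_sum_nonneg: "i < d \<Longrightarrow> 0 \<le> row_sum k i"
  by (induction k arbitrary: i)
     (auto simp: row_sum_0 row_sum_Suc intro!: sum_nonneg mult_nonneg_nonneg entry_nonneg)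

lemma row_sum_eq_sum_power:
  assumes "i < d"
  shows "complex_of_real (row_sum k i) = (\<Sum>j<d. (cplx_mat A ^\<^sub>m k) $$ (i, j))"
proof -
  have P: "A ^\<^sub>m k \<in> carrier_mat d d" for k using A by simp
  have shift: "power_method A x (Suc k) = power_method A (A *\<^sub>v x) k" for x k
    by (induction k) auto
  have pow: "power_method A x k = A ^\<^sub>m k *\<^sub>v x" if "x \<in> carrier_vec d" for x k
    using that
  proof (induction k arbitrary: x)
    case 0
    then show ?case using A by simp
  next
    case (Suc k)
    have "power_method A x (Suc k) = A ^\<^sub>m k *\<^sub>v (A *\<^sub>v x)"
      unfolding shift using Suc.prems A by (intro Suc.IH) simp
    also have "\<dots> = A ^\<^sub>m Suc k *\<^sub>v x"
      using assoc_mult_mat_vec[OF P A Suc.prems] by simp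
    finally show ?case .
  qed
  have ones: "ones_vec d \<in> carrier_vec d" by (simp add: ones_vec_def)
  have "(M *\<^sub>v ones_vec d) $ i = (\<Sum>j<d. M $$ (i, j))" if "M \<in> carrier_mat d d" for M
    using that assms by (auto simp: scalar_prod_def ones_vec_def lessThan_atLeast0)
  then have "row_sum k i = (\<Sum>j<d. (A ^\<^sub>m k) $$ (i, j))"
    unfolding row_sum_def pow[OF ones] using P by blast
  moreover have "cplx_mat A ^\<^sub>m k = map_mat complex_of_real (A ^\<^sub>m k)"
    unfolding cplx_mat_def by (rule of_real_hom.mat_hom_pow[OF A, symmetric])
  moreover have "map_mat complex_of_real M $$ (i, j) = complex_of_real (M $$ (i, j))"
    if "M \<in> carrier_mat d d" "j < d" for M j
    using that assms by auto
  ultimately show ?thesis using P by simp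
qed

lemma row_sum_induct:
  assumes i: "i < d"
    and zero: "S (\<lambda>_. 0)"
    and add: "\<And>f g. S f \<Longrightarrow> S g \<Longrightarrow> S (\<lambda>k. f k + g k)"
    and scale: "\<And>c f. S f \<Longrightarrow> S (\<lambda>k. c * f k)"
    and basic: "\<And>\<mu> t. \<mu> \<in> spectrum (cplx_mat A) \<Longrightarrow> S (\<lambda>k. of_nat (k choose t) * \<mu> ^ (k - t))"
  shows "S (\<lambda>k. complex_of_real (row_sum k i))"
proof -
  have "S (\<lambda>k. \<Sum>j\<in>J. (cplx_mat A ^\<^sub>m k) $$ (i, j))" if "finite J" "J \<subseteq> {..<d}" for J
    using that
  proof (induction J rule: finite_induct)
    case (insert j J)
    have "S (\<lambda>k. (cplx_mat A ^\<^sub>m k) $$ (i, j))"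
      by (rule matrix_power_entry_induct[OF cplx_carrier i, of j S])
         (use insert.prems zero add scale basic in auto)
    moreover have "S (\<lambda>k. \<Sum>j\<in>J. (cplx_mat A ^\<^sub>m k) $$ (i, j))"
      using insert by auto
    ultimately show ?case
      using insert.hyps by (simp add: add)
  qed (simp add: zero)
  then show ?thesis unfolding row_sum_eq_sum_power[OF i] by simp
qed

text \<open>An eigenvector \<open>x\<close> of a peripheral eigenvalue satisfies
  \<open>\<bar>\<mu>\<bar>\<^sup>k \<bar>x\<bar> \<le> A\<^sup>k \<bar>x\<bar> \<le> M A\<^sup>k e\<close> entrywise, where \<open>M\<close> is the largest modulus of its
  entries. Reading this at an index where \<open>M\<close> is attained gives one index that serves all \<open>k\<close>. The
  bound keeps the leading term of the row sums from vanishing and makes the resolvent blow up at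
  \<open>\<rho> A\<close>.\<close>

lemma row_sum_ge_rho_power: "\<exists>i<d. \<forall>k. \<rho> A ^ k \<le> row_sum k i"
proof -
  obtain \<mu> where \<mu>: "\<mu> \<in> spectrum (cplx_mat A)" "cmod \<mu> = \<rho> A" by (rule rho_attained)
  obtain x i0 where i0: "i0 < d" "x i0 \<noteq> 0"
    and x: "\<And>i. i < d \<Longrightarrow> \<mu> * x i = (\<Sum>j<d. of_real (A $$ (i, j)) * x j)"
    using \<mu>(1) unfolding spectrum_iff by blast
  define M where "M = Max ((\<lambda>i. cmod (x i)) ` {..<d})"
  have fin: "finite ((\<lambda>i. cmod (x i)) ` {..<d})" by simp
  have M: "cmod (x i) \<le> M" if "i < d" for i
    unfolding M_def using that by (intro Max_ge[OF fin]) auto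
  have "M \<in> (\<lambda>i. cmod (x i)) ` {..<d}"
    unfolding M_def using d by (intro Max_in[OF fin]) (auto simp: lessThan_empty_iff)
  then obtain i where i: "i < d" "cmod (x i) = M" by auto
  have M0: "0 < M" using M[OF i0(1)] i0(2) by (metis less_le_trans zero_less_norm_iff)
  have bound: "cmod (\<mu> ^ k * x i) \<le> M * row_sum k i" if "i < d" for k i
    using that
  proof (induction k arbitrary: i)
    case 0
    then show ?case using M by (simp add: row_sum_0)
  next
    case (Suc k)
    have "\<mu> ^ Suc k * x i = \<mu> ^ k * (\<mu> * x i)" by simp
    also have "\<dots> = (\<Sum>j<d. of_real (A $$ (i, j)) * (\<mu> ^ k * x j))"
      unfolding x[OF Suc.prems] by (simp add: sum_distrib_left mult_ac)
    also have "cmod \<dots> \<le> (\<Sum>j<d. A $$ (i, j) * (M * row_sum k j))"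
      using Suc.IH unfolding norm_mult[of \<mu>]
      by (intro sum_norm_le)
         (auto simp: norm_mult entry_nonneg Suc.prems intro!: mult_left_mono)
    also have "\<dots> = M * row_sum (Suc k) i"
      by (simp add: row_sum_Suc[OF Suc.prems] sum_distrib_left mult_ac)
    finally show ?case .
  qed
  have "\<rho> A ^ k \<le> row_sum k i" for k
    using bound[OF i(1), of k] i M0 \<mu>(2) by (simp add: norm_mult norm_power)
  then show ?thesis using i(1) by blast
qed

lemma row_sum_summable:
  assumes i: "i < d" and l: "\<rho> A < l"
  shows "summable (\<lambda>k. row_sum k i / l ^ k)"
proof -
  define S where "S = (\<lambda>f :: nat \<Rightarrow> complex. summable (\<lambda>k. norm (f k) / l ^ k))"
  have l0: "0 < l" using l rho_nonneg by linarith
  have "S (\<lambda>k. complex_of_real (row_sum k i))"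
  proof (rule row_sum_induct[OF i])
    show "S (\<lambda>k. f k + g k)" if "S f" "S g" for f g
      unfolding S_def
    proof (rule summable_comparison_test')
      show "summable (\<lambda>k. norm (f k) / l ^ k + norm (g k) / l ^ k)"
        using that unfolding S_def by (rule summable_add)
      show "norm (norm (f k + g k) / l ^ k) \<le> norm (f k) / l ^ k + norm (g k) / l ^ k" for k
        using divide_right_mono[OF norm_triangle_ineq[of "f k" "g k"], of "l ^ k"] l0
        by (simp add: add_divide_distrib)
    qed
    show "S (\<lambda>k. c * f k)" if "S f" for c f
      using summable_mult[OF that[unfolded S_def], of "norm c"] unfolding S_def by (simp add: norm_mult)
    show "S (\<lambda>k. of_nat (k choose t) * \<mu> ^ (k - t))" if "\<mu> \<in> spectrum (cplx_mat A)" for \<mu> t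
      unfolding S_def using spectrum_le_rho[OF that] l by (intro summable_binomial_exponential) simp
  qed (simp add: S_def)
  then show ?thesis unfolding S_def using row_sum_nonneg[OF i] by simp
qed

end

section \<open>Normalized vectors\<close>

lemma euclid_norm_eq: "euclid_norm v = sqrt (\<Sum>i<dim_vec v. (v $ i)\<^sup>2)"
  unfolding euclid_norm_def by (simp add: scalar_prod_def power2_eq_square lessThan_atLeast0)

lemma normalize_vec_index:
  "i < d \<Longrightarrow> normalize_vec (vec d f) $ i = f i / sqrt (\<Sum>j<d. (f j)\<^sup>2)"
  unfolding normalize_vec_def euclid_norm_eq by (simp add: field_simps)

lemma normalize_vec_carrier: "normalize_vec (vec d f) \<in> carrier_vec d"
  unfolding normalize_vec_def by simp

lemma sum_squares_pos:
  fixes f :: "nat \<Rightarrow> real"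
  assumes "i < d" "f i \<noteq> 0"
  shows "0 < (\<Sum>j<d. (f j)\<^sup>2)"
  by (rule sum_pos2[of _ i]) (use assms in auto)

text \<open>Normalization does not see positive scalar factors, so a direction can be computed from any
  rescaling that converges to a non-zero vector.\<close>

lemma normalize_vec_tendsto:
  fixes g :: "'a \<Rightarrow> nat \<Rightarrow> real"
  assumes lim: "\<And>i. i < d \<Longrightarrow> ((\<lambda>x. s x * g x i) \<longlongrightarrow> c i) F"
    and pos: "\<forall>\<^sub>F x in F. 0 < s x"
    and nz: "i0 < d" "c i0 \<noteq> 0"
  shows "vec_tendsto (\<lambda>x. normalize_vec (vec d (g x))) (normalize_vec (vec d c)) F"
  unfolding vec_tendsto_def
proof (intro conjI allI impI)
  have dim: "dim_vec (normalize_vec (vec d f)) = d" for f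
    using carrier_vecD[OF normalize_vec_carrier] .
  show "\<forall>\<^sub>F x in F. dim_vec (normalize_vec (vec d (g x))) = dim_vec (normalize_vec (vec d c))"
    unfolding dim by simp
  fix i assume "i < dim_vec (normalize_vec (vec d c))"
  then have i: "i < d" unfolding dim .
  have "((\<lambda>x. s x * g x i / sqrt (\<Sum>j<d. (s x * g x j)\<^sup>2)) \<longlongrightarrow> c i / sqrt (\<Sum>j<d. (c j)\<^sup>2)) F"
    using sum_squares_pos[of i0 d c, OF nz] by (intro tendsto_intros lim i) auto
  moreover have "\<forall>\<^sub>F x in F. s x * g x i / sqrt (\<Sum>j<d. (s x * g x j)\<^sup>2) = normalize_vec (vec d (g x)) $ i"
    using pos
  proof eventually_elim
    case (elim x)
    have "sqrt (\<Sum>j<d. (s x * g x j)\<^sup>2) = s x * sqrt (\<Sum>j<d. (g x j)\<^sup>2)"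
      using elim by (simp add: power_mult_distrib real_sqrt_mult flip: sum_distrib_left)
    then show ?case using elim unfolding normalize_vec_index[OF i] by simp
  qed
  ultimately show "((\<lambda>x. normalize_vec (vec d (g x)) $ i) \<longlongrightarrow> normalize_vec (vec d c) $ i) F"
    unfolding normalize_vec_index[OF i] by (rule Lim_transform_eventually)
qed

section \<open>The resolvent applied to the vector of ones\<close>

context nonneg_square_matrix
begin

text \<open>Entry \<open>i\<close> of the vector \<open>F(l) = l (l I - A)\<^sup>-\<^sup>1 e\<close>, by the Neumann series. It is meaningful for
  \<open>l > \<rho> A\<close>.\<close>

definition resolvent_sum :: "real \<Rightarrow> nat \<Rightarrow> real" where
  "resolvent_sum l i = (\<Sum>k. row_sum k i / l ^ k)"

lemma resolvent_sum_ge_1: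
  assumes "i < d" "\<rho> A < l"
  shows "1 \<le> resolvent_sum l i"
proof -
  have "(\<Sum>k<1. row_sum k i / l ^ k) \<le> resolvent_sum l i"
    unfolding resolvent_sum_def using assms rho_nonneg row_sum_nonneg
    by (intro sum_le_suminf row_sum_summable) auto
  then show ?thesis using assms by (simp add: row_sum_0)
qed

lemma resolvent_sum_antimono:
  assumes "i < d" "\<rho> A < l" "l \<le> l'"
  shows "resolvent_sum l' i \<le> resolvent_sum l i"
  unfolding resolvent_sum_def
proof (rule suminf_le)
  show "row_sum k i / l' ^ k \<le> row_sum k i / l ^ k" for k
    using assms rho_nonneg by (intro divide_left_mono power_mono mult_pos_pos zero_less_power row_sum_nonneg) auto
qed (use assms in \<open>auto intro!: row_sum_summable\<close>)

text \<open>The resolvent identity \<open>(l I - A) F = l e\<close>: applying \<open>A\<close> shifts the power series by one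
  term, and the term for \<open>k = 0\<close> is \<open>e\<close>.\<close>

lemma resolvent_sum_eq:
  assumes i: "i < d" and l: "\<rho> A < l"
  shows "(\<Sum>j<d. A $$ (i, j) * resolvent_sum l j) = l * (resolvent_sum l i - 1)"
proof -
  have l0: "0 < l" using l rho_nonneg by linarith
  have "(\<Sum>j<d. A $$ (i, j) * resolvent_sum l j) = (\<Sum>j<d. \<Sum>k. A $$ (i, j) * (row_sum k j / l ^ k))"
    unfolding resolvent_sum_def by (intro sum.cong refl suminf_mult[symmetric] row_sum_summable l) auto
  also have "\<dots> = (\<Sum>k. \<Sum>j<d. A $$ (i, j) * (row_sum k j / l ^ k))"
    by (intro suminf_sum[symmetric] summable_mult row_sum_summable l) auto
  also have "\<dots> = (\<Sum>k. l * (row_sum (Suc k) i / l ^ Suc k))"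
    using l0 by (simp add: row_sum_Suc[OF i] sum_divide_distrib sum_distrib_left)
  also have "\<dots> = l * (\<Sum>k. row_sum (Suc k) i / l ^ Suc k)"
    using row_sum_summable[OF i l] by (intro suminf_mult) (subst summable_Suc_iff)
  also have "(\<Sum>k. row_sum (Suc k) i / l ^ Suc k) = resolvent_sum l i - 1"
    unfolding resolvent_sum_def using suminf_split_head[OF row_sum_summable[OF i l]] i
    by (simp add: row_sum_0)
  finally show ?thesis .
qed

text \<open>A power series in \<open>1 / l\<close> is continuous inside its disc of convergence.\<close>

lemma continuous_on_resolvent_sum:
  assumes "i < d" "\<And>l. l \<in> L \<Longrightarrow> \<rho> A < l"
  shows "continuous_on L (\<lambda>l. resolvent_sum l i)"
proof (intro continuous_at_imp_continuous_on ballI)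
  fix l assume "l \<in> L"
  then have l: "\<rho> A < l" using assms by blast
  define r where "r = (\<rho> A + l) / 2"
  have r: "\<rho> A < r" "r < l" "0 < r" "0 < l" using l rho_nonneg unfolding r_def by auto
  have "isCont (\<lambda>z. \<Sum>k. row_sum k i * z ^ k) (inverse l)"
  proof (rule isCont_powser)
    show "summable (\<lambda>k. row_sum k i * inverse r ^ k)"
      using row_sum_summable[OF assms(1) r(1)] by (simp add: field_simps)
    show "norm (inverse l) < norm (inverse r)" using r by simp
  qed
  moreover have "isCont inverse l" using r by (intro continuous_intros) auto
  ultimately have "isCont (\<lambda>l. \<Sum>k. row_sum k i * inverse l ^ k) l" by (rule isCont_o2[rotated])
  then show "isCont (\<lambda>l. resolvent_sum l i) l"
    unfolding resolvent_sum_def by (simp add: field_simps)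
qed

lemma resolvent_sum_ge_geometric:
  assumes "i < d" "\<And>k. \<rho> A ^ k \<le> row_sum k i" "\<rho> A < l"
  shows "l / (l - \<rho> A) \<le> resolvent_sum l i"
proof -
  have l0: "0 < l" using assms rho_nonneg by linarith
  have x: "norm (\<rho> A / l) < 1" using assms l0 rho_nonneg by simp
  have "(\<Sum>k. (\<rho> A / l) ^ k) \<le> resolvent_sum l i"
    unfolding resolvent_sum_def using l0 assms
    by (intro suminf_le summable_geometric x row_sum_summable)
       (auto simp: power_divide intro!: divide_right_mono)
  also have "(\<Sum>k. (\<rho> A / l) ^ k) = l / (l - \<rho> A)"
    using suminf_geometric[OF x] l0 by (simp add: field_simps)
  finally show ?thesis .
qed

definition resolvent_total :: "real \<Rightarrow> real" where
  "resolvent_total l = (\<Sum>i<d. resolvent_sum l i)"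

lemma resolvent_total_ge:
  assumes l: "\<rho> A < l"
  shows "l / (l - \<rho> A) \<le> resolvent_total l"
proof -
  obtain i where i: "i < d" "\<And>k. \<rho> A ^ k \<le> row_sum k i" using row_sum_ge_rho_power by blast
  note resolvent_sum_ge_geometric[OF i l]
  also have "resolvent_sum l i \<le> resolvent_total l"
    unfolding resolvent_total_def
    by (rule member_le_sum) (use i resolvent_sum_ge_1[OF _ l] in \<open>force+\<close>)
  finally show ?thesis .
qed

lemma resolvent_total_antimono:
  "\<rho> A < l \<Longrightarrow> l \<le> l' \<Longrightarrow> resolvent_total l' \<le> resolvent_total l"
  unfolding resolvent_total_def by (intro sum_mono resolvent_sum_antimono) auto

text \<open>The intermediate value theorem on an interval that starts at \<open>\<rho> A + \<epsilon>\<close>. There the geometric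
  lower bound \<open>l / (l - \<rho> A)\<close> of the total gives \<open>l \<le> \<epsilon> e\<^sup>T F(l)\<close>, while for large \<open>l\<close> the total
  is bounded.\<close>

lemma secular_equation_solvable:
  assumes \<epsilon>: "0 < \<epsilon>"
  shows "\<exists>l\<ge>\<rho> A + \<epsilon>. l = \<epsilon> * resolvent_total l"
proof -
  define a where "a = \<rho> A + \<epsilon>"
  define b where "b = a + \<epsilon> * resolvent_total a"
  have a: "\<rho> A < a" "0 < a" unfolding a_def using \<epsilon> rho_nonneg by auto
  \<comment> \<open>The two endpoint inequalities: \<open>a\<close> is chosen so that \<open>a - \<rho> A = \<epsilon>\<close>, and \<open>b\<close> so that monotonicity of the
    total suffices.\<close>
  have "a / \<epsilon> \<le> resolvent_total a" using resolvent_total_ge[OF a(1)] by (simp add: a_def)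
  then have T: "a \<le> \<epsilon> * resolvent_total a" using \<epsilon> by (simp add: field_simps)
  then have ab: "a \<le> b" unfolding b_def using a by linarith
  have "\<epsilon> * resolvent_total b \<le> \<epsilon> * resolvent_total a"
    using \<epsilon> resolvent_total_antimono[OF a(1) ab] by simp
  then have Tb: "\<epsilon> * resolvent_total b \<le> b" unfolding b_def using a by linarith
  have "\<exists>l\<ge>a. l \<le> b \<and> l - \<epsilon> * resolvent_total l = 0"
  proof (rule IVT')
    show "continuous_on {a..b} (\<lambda>l. l - \<epsilon> * resolvent_total l)"
      unfolding resolvent_total_def using a by (intro continuous_intros continuous_on_resolvent_sum) auto
  qed (use T Tb ab in auto)
  then show ?thesis unfolding a_def by auto
qed

section \<open>The perturbed matrices\<close>

text \<open>A root of the secular equation. It is the spectral radius of the perturbed matrix, as shown in the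
  proof of \<open>perturbed_eigenvector_eq\<close>, and therefore unique.\<close>

definition perturbed_rho :: "real \<Rightarrow> real" where
  "perturbed_rho \<epsilon> = (SOME l. \<rho> A + \<epsilon> \<le> l \<and> l = \<epsilon> * resolvent_total l)"

lemma perturbed_rho:
  assumes "0 < \<epsilon>"
  shows "\<rho> A < perturbed_rho \<epsilon>" "\<epsilon> * resolvent_total (perturbed_rho \<epsilon>) = perturbed_rho \<epsilon>"
  using someI_ex[of "\<lambda>l. \<rho> A + \<epsilon> \<le> l \<and> l = \<epsilon> * resolvent_total l"] secular_equation_solvable[OF assms] assms
  unfolding perturbed_rho_def[symmetric] by auto

text \<open>At a root \<open>l \<ge> u > \<rho> A\<close> monotonicity would give
  \<open>u \<le> l = \<epsilon> e\<^sup>T F(l) \<le> \<epsilon> e\<^sup>T F(u)\<close>, which fails for small \<open>\<epsilon>\<close>.\<close>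

lemma perturbed_rho_tendsto: "filterlim perturbed_rho (at_right (\<rho> A)) (at_right 0)"
  unfolding filterlim_at
proof (intro conjI)
  have gt: "\<forall>\<^sub>F \<epsilon> in at_right 0. \<rho> A < perturbed_rho \<epsilon>"
    using eventually_at_right_less[of 0] by eventually_elim (rule perturbed_rho)
  then show "\<forall>\<^sub>F \<epsilon> in at_right 0. perturbed_rho \<epsilon> \<in> {\<rho> A<..} \<and> perturbed_rho \<epsilon> \<noteq> \<rho> A"
    by eventually_elim auto
  show "(perturbed_rho \<longlongrightarrow> \<rho> A) (at_right 0)"
  proof (rule order_tendstoI)
    fix u assume "\<rho> A < u"
    then have u: "\<rho> A < u" "0 < u" using rho_nonneg by auto
    have "((\<lambda>\<epsilon>. \<epsilon> * resolvent_total u) \<longlongrightarrow> 0 * resolvent_total u) (at_right 0)"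
      by (intro tendsto_intros)
    then have "\<forall>\<^sub>F \<epsilon> in at_right 0. \<epsilon> * resolvent_total u < u"
      using order_tendstoD(2)[of _ "0 * resolvent_total u" _ u] u by simp
    then show "\<forall>\<^sub>F \<epsilon> in at_right 0. perturbed_rho \<epsilon> < u"
      using eventually_at_right_less[of 0]
    proof eventually_elim
      case (elim \<epsilon>)
      show ?case
      proof (rule ccontr)
        assume "\<not> perturbed_rho \<epsilon> < u"
        then have "\<epsilon> * resolvent_total (perturbed_rho \<epsilon>) \<le> \<epsilon> * resolvent_total u"
          using elim u by (intro mult_left_mono resolvent_total_antimono) auto
        then show False using perturbed_rho(2)[OF elim(2)] elim \<open>\<not> perturbed_rho \<epsilon> < u\<close> by linarith
      qed
    qed
  next
    fix u assume "u < \<rho> A"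
    then show "\<forall>\<^sub>F \<epsilon> in at_right 0. u < perturbed_rho \<epsilon>"
      using gt by (auto elim: eventually_mono)
  qed
qed

lemma leading_eigenvector_iff:
  "leading_eigenvector A v \<longleftrightarrow>
    v \<in> carrier_vec d \<and> (\<exists>i<d. v $ i \<noteq> 0) \<and> (\<forall>i<d. (\<Sum>j<d. A $$ (i, j) * v $ j) = \<rho> A * v $ i)
      \<and> (\<forall>i<d. 0 \<le> v $ i)"
proof -
  have "0\<^sub>v (dim_row A) \<le> v \<longleftrightarrow> (\<forall>i<d. 0 \<le> v $ i)" if "v \<in> carrier_vec d"
    using that carrier_matD(1)[OF A] by (simp add: less_eq_vec_def)
  then show ?thesis unfolding leading_eigenvector_def eigenvector_iff by blast
qed

text \<open>By the resolvent identity and the secular equation, \<open>F(l)\<close> is a positive eigenvector of the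
  perturbed matrix for the eigenvalue \<open>l\<close>. The two Perron arguments above then identify \<open>l\<close> as the
  spectral radius and \<open>F(l)\<close> as the leading eigenvector, up to scaling.\<close>

lemma perturbed_eigenvector_eq:
  assumes \<epsilon>: "0 < \<epsilon>"
  shows "perturbed_eigenvector A \<epsilon> = normalize_vec (vec d (resolvent_sum (perturbed_rho \<epsilon>)))"
proof -
  define l where "l = perturbed_rho \<epsilon>"
  have l: "\<rho> A < l" "\<epsilon> * resolvent_total l = l" using perturbed_rho[OF \<epsilon>] unfolding l_def by auto
  let ?f = "resolvent_sum l" and ?B = "perturbed A \<epsilon>"
  have entry: "?B $$ (i, j) = A $$ (i, j) + \<epsilon>" if "i < d" "j < d" for i j
    using that A unfolding perturbed_def ones_mat_def by auto
  interpret B: nonneg_square_matrix ?B d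
  proof
    show carrier: "?B \<in> carrier_mat d d" using A unfolding perturbed_def ones_mat_def by auto
    then show "nonneg_matrix ?B"
      unfolding nonneg_matrix_def using entry entry_nonneg \<epsilon> by (auto intro!: add_nonneg_nonneg)
  qed (rule d)
  have pos: "0 < ?f i" if "i < d" for i using resolvent_sum_ge_1[OF that l(1)] by linarith
  have eig: "(\<Sum>j<d. ?B $$ (i, j) * ?f j) = l * ?f i" if "i < d" for i
  proof -
    have "(\<Sum>j<d. ?B $$ (i, j) * ?f j) = (\<Sum>j<d. A $$ (i, j) * ?f j) + \<epsilon> * resolvent_total l"
      using that by (simp add: entry distrib_right sum.distrib resolvent_total_def sum_distrib_left)
    then show ?thesis using resolvent_sum_eq[OF that l(1)] l(2) by (simp add: algebra_simps)
  qed
  have rho: "\<rho> ?B = l" by (rule B.rho_eq_of_positive_eigenvector[OF pos eig])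
  define N where "N = sqrt (\<Sum>j<d. (?f j)\<^sup>2)"
  have N: "0 < N" unfolding N_def using sum_squares_pos[of 0 d ?f] pos[OF d] d by simp
  let ?v = "normalize_vec (vec d ?f)"
  have v: "?v $ i = ?f i / N" if "i < d" for i
    unfolding normalize_vec_index[OF that] N_def ..
  have "perturbed_eigenvector A \<epsilon> = ?v"
    unfolding perturbed_eigenvector_def
  proof (rule the_equality)
    have "(\<Sum>j<d. (?f j / N)\<^sup>2) = (\<Sum>j<d. (?f j)\<^sup>2) / N\<^sup>2"
      by (simp add: power_divide sum_divide_distrib)
    also have "\<dots> = 1" using N unfolding N_def by simp
    finally have "euclid_norm ?v = 1"
      using normalize_vec_carrier[of d ?f] unfolding euclid_norm_eq by (simp add: v)
    moreover have "(\<Sum>j<d. ?B $$ (i, j) * ?v $ j) = l * ?v $ i" if "i < d" for i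
      using eig[OF that] that by (simp add: v flip: sum_divide_distrib)
    ultimately show "leading_eigenvector ?B ?v \<and> euclid_norm ?v = 1"
      unfolding B.leading_eigenvector_iff rho
      using normalize_vec_carrier[of d ?f] N pos d by (force simp: v less_imp_le)
  next
    fix u assume "leading_eigenvector ?B u \<and> euclid_norm u = 1"
    then have u: "u \<in> carrier_vec d" "\<And>i. i < d \<Longrightarrow> (\<Sum>j<d. ?B $$ (i, j) * u $ j) = l * u $ i"
      "\<And>i. i < d \<Longrightarrow> 0 \<le> u $ i" "euclid_norm u = 1"
      unfolding B.leading_eigenvector_iff rho by auto
    obtain t where t: "\<And>i. i < d \<Longrightarrow> u $ i = t * ?f i"
      using B.nonneg_eigenvector_unique[OF _ pos eig u(2)] entry entry_nonneg \<epsilon>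
      by (metis add_nonneg_pos)
    have t0: "0 \<le> t" using t[OF d] u(3)[OF d] pos[OF d] by (simp add: zero_le_mult_iff)
    have "euclid_norm u = sqrt (t\<^sup>2 * (\<Sum>j<d. (?f j)\<^sup>2))"
      using u(1) unfolding euclid_norm_eq by (simp add: t power_mult_distrib sum_distrib_left)
    also have "\<dots> = t * N" using t0 unfolding N_def by (simp add: real_sqrt_mult)
    finally have "t = 1 / N" using u(4) N by (simp add: field_simps)
    then show "u = ?v"
      using u(1) normalize_vec_carrier[of d ?f] by (intro eq_vecI) (auto simp: v t)
  qed
  then show ?thesis unfolding l_def .
qed

text \<open>This reduces the selected leading eigenvector to the unperturbed matrix: only the direction of the
  resolvent applied to \<open>e\<close> near \<open>\<rho> A\<close> matters.\<close>

lemma selected_leading_eigenvector_of_resolvent_limit: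
  assumes lim: "\<And>i. i < d \<Longrightarrow> ((\<lambda>l. s l * resolvent_sum l i) \<longlongrightarrow> c i) (at_right (\<rho> A))"
    and pos: "\<And>l. \<rho> A < l \<Longrightarrow> 0 < s l"
    and nz: "i0 < d" "c i0 \<noteq> 0"
  shows "selected_leading_eigenvector A (normalize_vec (vec d c))"
proof -
  let ?g = "\<lambda>\<epsilon>. normalize_vec (vec d (resolvent_sum (perturbed_rho \<epsilon>)))"
  have "vec_tendsto ?g (normalize_vec (vec d c)) (at_right 0)"
  proof (rule normalize_vec_tendsto[where s = "\<lambda>\<epsilon>. s (perturbed_rho \<epsilon>)"])
    show "((\<lambda>\<epsilon>. s (perturbed_rho \<epsilon>) * resolvent_sum (perturbed_rho \<epsilon>) i) \<longlongrightarrow> c i) (at_right 0)" if "i < d" for i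
      by (rule filterlim_compose[OF lim[OF that] perturbed_rho_tendsto])
    show "\<forall>\<^sub>F \<epsilon> in at_right 0. 0 < s (perturbed_rho \<epsilon>)"
      using eventually_at_right_less[of 0] by eventually_elim (intro pos perturbed_rho)
  qed (fact nz)+
  moreover have eq: "\<forall>\<^sub>F \<epsilon> in at_right 0. perturbed_eigenvector A \<epsilon> = ?g \<epsilon>"
    using eventually_at_right_less[of 0] by eventually_elim (rule perturbed_eigenvector_eq)
  ultimately have "vec_tendsto (perturbed_eigenvector A) (normalize_vec (vec d c)) (at_right 0)"
    unfolding vec_tendsto_def
  proof (elim conjE, intro conjI allI impI)
    assume "\<forall>\<^sub>F \<epsilon> in at_right 0. dim_vec (?g \<epsilon>) = dim_vec (normalize_vec (vec d c))"
    with eq show "\<forall>\<^sub>F \<epsilon> in at_right 0. dim_vec (perturbed_eigenvector A \<epsilon>) = dim_vec (normalize_vec (vec d c))"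
      by eventually_elim simp
    fix i assume "i < dim_vec (normalize_vec (vec d c))"
      and "\<forall>i<dim_vec (normalize_vec (vec d c)). ((\<lambda>\<epsilon>. ?g \<epsilon> $ i) \<longlongrightarrow> normalize_vec (vec d c) $ i) (at_right 0)"
    then have "((\<lambda>\<epsilon>. ?g \<epsilon> $ i) \<longlongrightarrow> normalize_vec (vec d c) $ i) (at_right 0)" by blast
    moreover have "\<forall>\<^sub>F \<epsilon> in at_right 0. ?g \<epsilon> $ i = perturbed_eigenvector A \<epsilon> $ i"
      using eq by eventually_elim simp
    ultimately show "((\<lambda>\<epsilon>. perturbed_eigenvector A \<epsilon> $ i) \<longlongrightarrow> normalize_vec (vec d c) $ i) (at_right 0)"
      by (rule Lim_transform_eventually)
  qed
  then show ?thesis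
    unfolding selected_leading_eigenvector_def using normalize_vec_carrier A by auto
qed

end

section \<open>Leading terms of polynomials and an Abelian theorem\<close>

lemma poly_over_power_tendsto:
  fixes p :: "complex poly"
  assumes "degree p \<le> m"
  shows "(\<lambda>k. poly p (of_nat k) / of_nat k ^ m) \<longlonglongrightarrow> coeff p m"
proof -
  have monomial: "(\<lambda>k. coeff p t * (of_nat k ^ t / of_nat k ^ m)) \<longlonglongrightarrow> (if t = m then coeff p m else 0)"
    if "t \<le> m" for t
  proof (cases "t = m")
    case True
    have "\<forall>\<^sub>F k in sequentially. coeff p m = coeff p t * (of_nat k ^ t / of_nat k ^ m)"
      using eventually_gt_at_top[of 0] by eventually_elim (simp add: True)
    then show ?thesis using True by (simp add: tendsto_eventually eventually_mono)
  next
    case False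
    with that have "t < m" by simp
    have "(\<lambda>k. coeff p t * inverse (of_nat k) ^ (m - t)) \<longlonglongrightarrow> coeff p t * 0 ^ (m - t)"
      by (intro tendsto_intros lim_inverse_n)
    moreover have "\<forall>\<^sub>F k in sequentially. coeff p t * inverse (of_nat k) ^ (m - t) = coeff p t * (of_nat k ^ t / of_nat k ^ m)"
      using eventually_gt_at_top[of 0]
    proof eventually_elim
      case (elim k)
      have "(of_nat k :: complex) ^ m = of_nat k ^ t * of_nat k ^ (m - t)"
        using \<open>t < m\<close> by (simp flip: power_add)
      then show ?case using elim by (simp add: field_simps)
    qed
    ultimately have "(\<lambda>k. coeff p t * (of_nat k ^ t / of_nat k ^ m)) \<longlonglongrightarrow> coeff p t * 0 ^ (m - t)"
      by (rule Lim_transform_eventually)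
    then show ?thesis using \<open>t < m\<close> by (simp add: power_0_left)
  qed
  have "(\<lambda>k. \<Sum>t\<le>m. coeff p t * (of_nat k ^ t / of_nat k ^ m)) \<longlonglongrightarrow> (\<Sum>t\<le>m. if t = m then coeff p m else 0)"
    by (intro tendsto_sum monomial) simp
  moreover have "poly p x = (\<Sum>t\<le>m. coeff p t * x ^ t)" for x
    unfolding poly_altdef using assms
    by (intro sum.mono_neutral_left) (auto simp: coeff_eq_0)
  ultimately show ?thesis by (simp add: sum_divide_distrib)
qed

text \<open>The terms with \<open>k < N\<close> contribute a bounded amount, which the divergence of the denominator makes
  negligible; in the remaining terms \<open>f k\<close> differs from \<open>c * b k\<close> by at most a small multiple of
  \<open>b k\<close>.\<close>

lemma abel_quotient_tendsto:
  fixes f b :: "nat \<Rightarrow> real"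
  assumes b: "\<And>k. 0 \<le> b k"
    and b0: "\<forall>\<^sub>F k in sequentially. 0 < b k"
    and lim: "(\<lambda>k. f k / b k) \<longlonglongrightarrow> c"
    and sb: "\<And>x. 0 \<le> x \<Longrightarrow> x < 1 \<Longrightarrow> summable (\<lambda>k. b k * x ^ k)"
    and sf: "\<And>x. 0 \<le> x \<Longrightarrow> x < 1 \<Longrightarrow> summable (\<lambda>k. f k * x ^ k)"
    and div: "filterlim (\<lambda>x. \<Sum>k. b k * x ^ k) at_top (at_left 1)"
  shows "((\<lambda>x. (\<Sum>k. f k * x ^ k) / (\<Sum>k. b k * x ^ k)) \<longlongrightarrow> c) (at_left 1)"
proof (rule tendstoI)
  fix e :: real assume e: "0 < e"
  have "\<forall>\<^sub>F k in sequentially. dist (f k / b k) c < e / 3"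
    using e by (intro tendstoD[OF lim]) simp
  then have "\<forall>\<^sub>F k in sequentially. \<bar>f k - c * b k\<bar> \<le> e / 3 * b k"
    using b0
  proof eventually_elim
    case (elim k)
    have "f k - c * b k = (f k / b k - c) * b k" using elim by (simp add: field_simps)
    then have "\<bar>f k - c * b k\<bar> = \<bar>f k / b k - c\<bar> * b k" using elim by (simp add: abs_mult)
    then show ?case using elim
      by (metis dist_real_def less_imp_le mult_right_mono)
  qed
  then obtain N where N: "\<And>k. N \<le> k \<Longrightarrow> \<bar>f k - c * b k\<bar> \<le> e / 3 * b k"
    unfolding eventually_sequentially by blast
  define M where "M = (\<Sum>k<N. \<bar>f k - c * b k\<bar>)"
  let ?F = "\<lambda>x. \<Sum>k. f k * x ^ k" and ?B = "\<lambda>x. \<Sum>k. b k * x ^ k"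
  have bound: "\<bar>?F x - c * ?B x\<bar> \<le> M + e / 3 * ?B x" if x: "0 \<le> x" "x < 1" for x
  proof -
    \<comment> \<open>The head of the series, with \<open>x\<^sup>k\<close> bounded by 1.\<close>
    let ?u = "\<lambda>k. if k < N then \<bar>f k - c * b k\<bar> else 0"
    have "?u sums (\<Sum>k<N. ?u k)" by (rule sums_finite) auto
    then have u: "?u sums M" unfolding M_def by simp
    have total: "(\<lambda>k. ?u k + e / 3 * (b k * x ^ k)) sums (M + e / 3 * ?B x)"
      by (intro sums_add u sums_mult summable_sums sb x)
    then have s: "summable (\<lambda>k. ?u k + e / 3 * (b k * x ^ k))" by (rule sums_summable)
    have "?F x - c * ?B x = (\<Sum>k. (f k - c * b k) * x ^ k)"
      using sf[OF x] sb[OF x]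
      by (simp add: suminf_mult suminf_diff summable_mult algebra_simps flip: suminf_mult)
    also have "\<bar>\<dots>\<bar> \<le> (\<Sum>k. ?u k + e / 3 * (b k * x ^ k))"
    proof (rule norm_suminf_le[where f = "\<lambda>k. (f k - c * b k) * x ^ k", OF _ s, unfolded real_norm_def])
      fix k
      have x1: "x ^ k \<le> 1" "0 \<le> x ^ k" using x by (auto simp: power_le_one)
      show "\<bar>(f k - c * b k) * x ^ k\<bar> \<le> ?u k + e / 3 * (b k * x ^ k)"
      proof (cases "k < N")
        case True
        have "\<bar>f k - c * b k\<bar> * x ^ k \<le> \<bar>f k - c * b k\<bar>" using x1 by (simp add: mult_left_le)
        moreover have "0 \<le> e / 3 * (b k * x ^ k)" using e b x1 by simp
        ultimately show ?thesis using True x1 by (simp add: abs_mult)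
      next
        case False
        then have "\<bar>f k - c * b k\<bar> * x ^ k \<le> e / 3 * b k * x ^ k"
          using N[of k] x1 by (intro mult_right_mono) auto
        then show ?thesis using False x1 by (simp add: abs_mult mult.assoc)
      qed
    qed
    also have "\<dots> = M + e / 3 * ?B x"
      by (rule sums_unique[OF total, symmetric])
    finally show ?thesis .
  qed
  \<comment> \<open>The bound 1 keeps the denominator positive, the bound \<open>3 * M / e\<close> absorbs the head.\<close>
  have "\<forall>\<^sub>F x in at_left (1::real). max 1 (3 * M / e) \<le> ?B x"
    using div unfolding filterlim_at_top by blast
  moreover have "\<forall>\<^sub>F x in at_left (1::real). x \<in> {0<..<1}"
    by (rule eventually_at_left_real) simp
  ultimately show "\<forall>\<^sub>F x in at_left 1. dist (?F x / ?B x) c < e"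
  proof eventually_elim
    case (elim x)
    then have B: "0 < ?B x" and M: "M \<le> e / 3 * ?B x" using e by (auto simp: field_simps)
    have "?F x / ?B x - c = (?F x - c * ?B x) / ?B x" using B by (simp add: field_simps)
    then have "dist (?F x / ?B x) c = \<bar>?F x - c * ?B x\<bar> / ?B x"
      using B by (simp add: dist_real_def)
    also have "\<dots> \<le> (M + e / 3 * ?B x) / ?B x"
      using bound[of x] elim B by (intro divide_right_mono) auto
    also have "\<dots> < e"
    proof -
      have "0 < e * ?B x" using e B by simp
      then have "M + e / 3 * ?B x < e * ?B x" using M by linarith
      then show ?thesis using B by (simp add: pos_divide_less_eq)
    qed
    finally show ?case .
  qed
qed

text \<open>Apart from the term for \<open>k = 0\<close>, the series dominates the geometric series.\<close>

lemma power_weight_series_at_top: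
  "filterlim (\<lambda>x::real. \<Sum>k. of_nat k ^ m * x ^ k) at_top (at_left 1)"
proof (rule filterlim_at_top_mono)
  show "filterlim (\<lambda>x::real. 1 / (1 - x) - 1) at_top (at_left 1)"
  proof -
    have "filterlim (\<lambda>x::real. 1 - x) (at_right 0) (at_left 1)"
      by (rule filterlim_at_withinI) 
         (auto intro!: tendsto_eq_intros eventually_at_leftI[of 0])
    from filterlim_compose[OF filterlim_inverse_at_top_right this]
    have "filterlim (\<lambda>x::real. inverse (1 - x)) at_top (at_left 1)" .
    then have "filterlim (\<lambda>x::real. -1 + inverse (1 - x)) at_top (at_left 1)"
      by (rule filterlim_tendsto_add_at_top[OF tendsto_const])
    then show ?thesis by (simp add: field_simps)
  qed
  have "\<forall>\<^sub>F x in at_left (1::real). x \<in> {0<..<1}"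
    by (rule eventually_at_left_real) simp
  then show "\<forall>\<^sub>F x in at_left (1::real). 1 / (1 - x) - 1 \<le> (\<Sum>k. of_nat k ^ m * x ^ k)"
  proof eventually_elim
    case (elim x)
    then have x: "norm x < 1" "0 \<le> x" by auto
    have "1 / (1 - x) - 1 = (\<Sum>k. x ^ Suc k)"
      using suminf_split_head[OF summable_geometric[OF x(1)]] suminf_geometric[OF x(1)] by simp
    also have "\<dots> \<le> (\<Sum>k. of_nat (Suc k) ^ m * x ^ Suc k)"
    proof (rule suminf_le)
      show "x ^ Suc k \<le> of_nat (Suc k) ^ m * x ^ Suc k" for k
      proof -
        have "1 \<le> real (Suc k) ^ m" by (rule one_le_power) simp
        from mult_right_mono[OF this, of "x ^ Suc k"] x show ?thesis by simp
      qed
      show "summable (\<lambda>k. x ^ Suc k)"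
        using summable_geometric[OF x(1)] by (subst summable_Suc_iff)
      show "summable (\<lambda>k. real (Suc k) ^ m * x ^ Suc k)"
        using summable_nat_power_times_geometric[OF x(1), of m] by (subst summable_Suc_iff)
    qed
    also have "\<dots> = (\<Sum>k. of_nat k ^ m * x ^ k) - of_nat 0 ^ m * x ^ 0"
      by (rule suminf_split_head[OF summable_nat_power_times_geometric[OF x(1)]])
    also have "\<dots> \<le> (\<Sum>k. of_nat k ^ m * x ^ k)" by simp
    finally show ?case .
  qed
qed

section \<open>Asymptotic direction of the row sums and of the resolvent\<close>

context nonneg_square_matrix
begin

text \<open>Divided by \<open>l\<^sup>k\<close>, where \<open>l\<close> is the peripheral eigenvalue, each row sum is a polynomial in \<open>k\<close>
  up to a vanishing error. With \<open>m\<close> the largest degree of these polynomials, the limits after further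
  division by \<open>k\<^sup>m\<close> exist. The row sums are non-negative, so passing to absolute values
  replaces \<open>l\<close> by \<open>\<rho> A\<close>; in this way the limit is obtained before anything is known about the
  argument of \<open>l\<close>.\<close>

lemma row_sum_leading_term:
  assumes rho: "0 < \<rho> A" and unique: "unique_peripheral_eigenvalue A"
  obtains m c where "\<And>i. i < d \<Longrightarrow> (\<lambda>k. row_sum k i / (\<rho> A ^ k * of_nat k ^ m)) \<longlonglongrightarrow> c i"
    and "\<And>i. i < d \<Longrightarrow> 0 \<le> c i" and "\<exists>i<d. c i \<noteq> 0"
proof -
  obtain l where l: "l \<in> spectrum (cplx_mat A)" "cmod l = \<rho> A"
    and other: "\<And>\<mu>. \<mu> \<in> spectrum (cplx_mat A) \<Longrightarrow> cmod \<mu> = \<rho> A \<Longrightarrow> \<mu> = l"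
    using unique unfolding unique_peripheral_eigenvalue_def by blast
  have l0: "l \<noteq> 0" using l(2) rho by auto
  have "exp_poly_asymptotics l (\<lambda>k. complex_of_real (row_sum k i))" if "i < d" for i
  proof (rule row_sum_induct[OF that])
    fix \<mu> t assume \<mu>: "\<mu> \<in> spectrum (cplx_mat A)"
    show "exp_poly_asymptotics l (\<lambda>k. of_nat (k choose t) * \<mu> ^ (k - t))"
    proof (cases "\<mu> = l")
      case True
      then show ?thesis using exp_poly_asymptotics_dominant[OF l0] by simp
    next
      case False
      then show ?thesis
        using spectrum_le_rho[OF \<mu>] other[OF \<mu>] l(2) by (intro exp_poly_asymptotics_dominated) force
    qed
  qed (intro exp_poly_asymptotics_zero exp_poly_asymptotics_add exp_poly_asymptotics_scale; assumption)+
  then obtain p where p: "\<And>i. i < d \<Longrightarrow> (\<lambda>k. row_sum k i / l ^ k - poly (p i) (of_nat k)) \<longlonglongrightarrow> 0"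
    unfolding exp_poly_asymptotics_def by metis
  have norm_quot: "norm (complex_of_real (row_sum k i) / l ^ k) = row_sum k i / \<rho> A ^ k" if "i < d" for k i
    using row_sum_nonneg[OF that] l(2) by (simp add: norm_divide norm_power)
  obtain i0 where i0: "i0 < d" "\<And>k. \<rho> A ^ k \<le> row_sum k i0" using row_sum_ge_rho_power by blast
  \<comment> \<open>Otherwise this row sum would be of smaller order than \<open>\<rho> A\<^sup>k\<close>, against the choice of \<open>i0\<close>.\<close>
  have p0: "p i0 \<noteq> 0"
  proof
    assume "p i0 = 0"
    then have "(\<lambda>k. row_sum k i0 / \<rho> A ^ k) \<longlonglongrightarrow> 0"
      using tendsto_norm_zero[OF p[OF i0(1)]] norm_quot[OF i0(1)] by simp
    moreover have "1 \<le> row_sum k i0 / \<rho> A ^ k" for k using i0(2) rho by simp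
    ultimately have "1 \<le> (0::real)" by (intro LIMSEQ_le_const) auto
    then show False by simp
  qed
  define m where "m = Max ((\<lambda>i. degree (p i)) ` {..<d})"
  have fin: "finite ((\<lambda>i. degree (p i)) ` {..<d})" by simp
  have deg: "degree (p i) \<le> m" if "i < d" for i
    unfolding m_def using that by (intro Max_ge[OF fin]) auto
  define c where "c = (\<lambda>i. norm (coeff (p i) m))"
  have lim: "(\<lambda>k. row_sum k i / (\<rho> A ^ k * of_nat k ^ m)) \<longlonglongrightarrow> c i" if i: "i < d" for i
  proof -
    let ?r = "\<lambda>k. row_sum k i / l ^ k - poly (p i) (of_nat k)"
    have "(\<lambda>k. ?r k / of_nat k ^ m) \<longlonglongrightarrow> 0"
    proof (rule tendsto_0_le[OF p[OF i], where K = 1])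
      show "\<forall>\<^sub>F k in sequentially. norm (?r k / of_nat k ^ m) \<le> norm (?r k) * 1"
        using eventually_gt_at_top[of 0]
      proof eventually_elim
        case (elim k)
        then have "1 \<le> real k ^ m" by (intro one_le_power) simp
        from divide_left_mono[OF this norm_ge_zero[of "?r k"]] elim
        have "norm (?r k) / real k ^ m \<le> norm (?r k)" by simp
        then show ?case by (simp add: norm_divide norm_power)
      qed
    qed
    from tendsto_add[OF this poly_over_power_tendsto[OF deg[OF i]]]
    have "(\<lambda>k. row_sum k i / l ^ k / of_nat k ^ m) \<longlonglongrightarrow> coeff (p i) m"
      by (simp add: diff_divide_distrib)
    from tendsto_norm[OF this] show ?thesis
      unfolding c_def norm_divide[of "row_sum _ i / l ^ _"] norm_quot[OF i] by (simp add: norm_power)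
  qed
  have "\<exists>i<d. coeff (p i) m \<noteq> 0"
  \<comment> \<open>If \<open>m = 0\<close>, the maximal degree may be attained by a zero polynomial, so \<open>p i0\<close> is used instead.\<close>
  proof (cases "m = 0")
    case True
    then have "coeff (p i0) m = lead_coeff (p i0)" using deg[OF i0(1)] by simp
    then show ?thesis using p0 i0(1) by (intro exI[of _ i0]) simp
  next
    case False
    have "m \<in> (\<lambda>i. degree (p i)) ` {..<d}"
      unfolding m_def using d by (intro Max_in[OF fin]) (auto simp: lessThan_empty_iff)
    then obtain i where i: "i < d" "m = degree (p i)" by auto
    then have "p i \<noteq> 0" using False by auto
    then show ?thesis using i by (intro exI[of _ i]) simp
  qed
  then have "\<exists>i<d. c i \<noteq> 0" unfolding c_def by simp
  moreover have "0 \<le> c i" for i unfolding c_def by simp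
  ultimately show thesis using lim that by blast
qed

text \<open>The sequence \<open>A (A\<^sup>k e) / (\<rho> A\<^sup>k k\<^sup>m)\<close> has two descriptions: it is \<open>A\<close> applied to a sequence that
  converges to \<open>c\<close>, and, up to a factor that tends to \<open>\<rho> A\<close>, it is the next term of that sequence.\<close>

lemma leading_term_eigenvector:
  assumes rho: "0 < \<rho> A"
    and lim: "\<And>i. i < d \<Longrightarrow> (\<lambda>k. row_sum k i / (\<rho> A ^ k * of_nat k ^ m)) \<longlonglongrightarrow> c i"
    and i: "i < d"
  shows "(\<Sum>j<d. A $$ (i, j) * c j) = \<rho> A * c i"
proof (rule LIMSEQ_unique)
  show "(\<lambda>k. \<Sum>j<d. A $$ (i, j) * (row_sum k j / (\<rho> A ^ k * of_nat k ^ m))) \<longlonglongrightarrow> (\<Sum>j<d. A $$ (i, j) * c j)"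
    by (intro tendsto_intros lim) simp
  have "(\<lambda>k. real k / real (Suc k)) \<longlonglongrightarrow> 1" by (rule LIMSEQ_n_over_Suc_n)
  then have "(\<lambda>k. inverse (real k / real (Suc k))) \<longlonglongrightarrow> inverse 1" by (rule tendsto_inverse) simp
  then have ratio: "(\<lambda>k. real (Suc k) / real k) \<longlonglongrightarrow> 1" by simp
  have "(\<lambda>k. \<rho> A * (real (Suc k) / real k) ^ m * (row_sum (Suc k) i / (\<rho> A ^ Suc k * of_nat (Suc k) ^ m)))
      \<longlonglongrightarrow> \<rho> A * 1 ^ m * c i"
    by (intro tendsto_intros ratio LIMSEQ_Suc[OF lim[OF i]])
  moreover have "\<forall>\<^sub>F k in sequentially.
      \<rho> A * (real (Suc k) / real k) ^ m * (row_sum (Suc k) i / (\<rho> A ^ Suc k * of_nat (Suc k) ^ m)) =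
      (\<Sum>j<d. A $$ (i, j) * (row_sum k j / (\<rho> A ^ k * of_nat k ^ m)))"
    using eventually_gt_at_top[of 0]
  proof eventually_elim
    case (elim k)
    have "(\<Sum>j<d. A $$ (i, j) * (row_sum k j / (\<rho> A ^ k * of_nat k ^ m))) =
        row_sum (Suc k) i / (\<rho> A ^ k * of_nat k ^ m)"
      by (simp add: row_sum_Suc[OF i] sum_divide_distrib)
    then show ?case using rho elim by (simp add: power_divide del: of_nat_Suc)
  qed
  ultimately show "(\<lambda>k. \<Sum>j<d. A $$ (i, j) * (row_sum k j / (\<rho> A ^ k * of_nat k ^ m))) \<longlonglongrightarrow> \<rho> A * c i"
    using Lim_transform_eventually by force
qed

text \<open>The Abelian theorem in the variable \<open>x = \<rho> A / l\<close>, with weights \<open>k\<^sup>m\<close>.\<close>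

lemma resolvent_sum_direction:
  assumes rho: "0 < \<rho> A"
    and lim: "\<And>i. i < d \<Longrightarrow> (\<lambda>k. row_sum k i / (\<rho> A ^ k * of_nat k ^ m)) \<longlonglongrightarrow> c i"
    and i: "i < d"
  shows "((\<lambda>l. inverse (\<Sum>k. of_nat k ^ m * (\<rho> A / l) ^ k) * resolvent_sum l i) \<longlongrightarrow> c i) (at_right (\<rho> A))"
proof -
  let ?f = "\<lambda>k. row_sum k i / \<rho> A ^ k"
  have terms: "?f k * x ^ k = row_sum k i / (\<rho> A / x) ^ k" for k x
    by (simp add: power_divide)
  have "((\<lambda>x. (\<Sum>k. ?f k * x ^ k) / (\<Sum>k. of_nat k ^ m * x ^ k)) \<longlongrightarrow> c i) (at_left 1)"
  proof (rule abel_quotient_tendsto)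
    show "\<forall>\<^sub>F k in sequentially. 0 < real k ^ m"
      using eventually_gt_at_top[of 0] by eventually_elim simp
    show "(\<lambda>k. ?f k / real k ^ m) \<longlonglongrightarrow> c i" using lim[OF i] by simp
    show "summable (\<lambda>k. real k ^ m * x ^ k)" if "0 \<le> x" "x < 1" for x
      using that by (intro summable_nat_power_times_geometric) simp
    show "summable (\<lambda>k. ?f k * x ^ k)" if x: "0 \<le> x" "x < 1" for x
    proof (cases "x = 0")
      case True
      then show ?thesis by (intro summable_finite[of "{0}"]) auto
    next
      case False
      with x have "\<rho> A < \<rho> A / x" using rho by (simp add: field_simps)
      then show ?thesis unfolding terms by (rule row_sum_summable[OF i])
    qed
  qed (simp_all add: power_weight_series_at_top)
  moreover have "filterlim (\<lambda>l. \<rho> A / l) (at_left 1) (at_right (\<rho> A))"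
  proof (rule filterlim_at_withinI)
    show "((\<lambda>l. \<rho> A / l) \<longlongrightarrow> 1) (at_right (\<rho> A))"
      using rho by (auto intro!: tendsto_eq_intros)
    show "\<forall>\<^sub>F l in at_right (\<rho> A). \<rho> A / l \<in> {..<1} - {1}"
      using eventually_at_right_less[of "\<rho> A"] by eventually_elim (use rho in auto)
  qed
  ultimately have "((\<lambda>l. (\<Sum>k. ?f k * (\<rho> A / l) ^ k) / (\<Sum>k. of_nat k ^ m * (\<rho> A / l) ^ k)) \<longlongrightarrow> c i) (at_right (\<rho> A))"
    by (rule filterlim_compose)
  then show ?thesis
    unfolding resolvent_sum_def using rho by (simp add: terms field_simps)
qed

text \<open>All eigenvalues are 0, so the series for the resolvent is finite, and the power \<open>l\<^sup>-\<^sup>m\<close> of its last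
  non-zero term dominates near 0.\<close>

lemma nilpotent_resolvent_sum_direction:
  assumes rho: "\<rho> A = 0"
  obtains m where "\<And>i. i < d \<Longrightarrow> ((\<lambda>l. l ^ m * resolvent_sum l i) \<longlongrightarrow> row_sum m i) (at_right (\<rho> A))"
    and "\<exists>i<d. row_sum m i \<noteq> 0"
proof -
  have "\<forall>\<^sub>F k in sequentially. complex_of_real (row_sum k i) = 0" if "i < d" for i
  proof (rule row_sum_induct[OF that, where S = "\<lambda>f. \<forall>\<^sub>F k in sequentially. f k = 0"])
    show "\<forall>\<^sub>F k in sequentially. of_nat (k choose t) * \<mu> ^ (k - t) = 0"
      if "\<mu> \<in> spectrum (cplx_mat A)" for \<mu> t
      using spectrum_le_rho[OF that] rho binomial_nilpotent_eventually_zero[of t] by simp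
  qed (auto elim: eventually_elim2 eventually_mono)
  then have "\<forall>\<^sub>F k in sequentially. \<forall>i\<in>{..<d}. row_sum k i = 0"
    by (subst eventually_ball_finite_distrib) auto
  then obtain N where N: "\<And>k i. N \<le> k \<Longrightarrow> i < d \<Longrightarrow> row_sum k i = 0"
    unfolding eventually_sequentially by auto
  let ?P = "\<lambda>k. \<exists>i<d. row_sum k i \<noteq> 0"
  define m where "m = (GREATEST k. ?P k)"
  have P0: "?P 0" using d row_sum_0[OF d] by force
  have b: "\<forall>k. ?P k \<longrightarrow> k \<le> N" using N by (meson nat_le_linear)
  have m: "?P m" unfolding m_def by (rule GreatestI_nat[where P = ?P and k = 0 and b = N]) (use P0 b in blast)+
  have zero: "row_sum k i = 0" if "m < k" "i < d" for k i
    using Greatest_le_nat[of ?P k N] b that unfolding m_def[symmetric] by (meson not_le)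
  have "((\<lambda>l. l ^ m * resolvent_sum l i) \<longlongrightarrow> row_sum m i) (at_right (\<rho> A))" if i: "i < d" for i
  proof -
    have "((\<lambda>l::real. \<Sum>k\<le>m. row_sum k i * l ^ (m - k)) \<longlongrightarrow> (\<Sum>k\<le>m. row_sum k i * 0 ^ (m - k))) (at_right 0)"
      by (intro tendsto_intros)
    moreover have "(\<Sum>k\<le>m. row_sum k i * 0 ^ (m - k)) = row_sum m i"
      by (subst sum.remove[of _ m]) (auto simp: power_0_left intro!: sum.neutral)
    moreover have "\<forall>\<^sub>F l in at_right 0. (\<Sum>k\<le>m. row_sum k i * l ^ (m - k)) = l ^ m * resolvent_sum l i"
      using eventually_at_right_less[of 0]
    proof eventually_elim
      case (elim l)
      have "resolvent_sum l i = (\<Sum>k\<le>m. row_sum k i / l ^ k)"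
        unfolding resolvent_sum_def by (rule suminf_finite) (auto simp: zero i)
      then show ?case using elim by (simp add: sum_distrib_left power_diff mult.commute)
    qed
    ultimately show ?thesis unfolding rho by (simp add: Lim_transform_eventually)
  qed
  then show thesis using m that by blast
qed

lemma power_method_converges:
  assumes rho: "0 < \<rho> A"
    and lim: "\<And>i. i < d \<Longrightarrow> (\<lambda>k. row_sum k i / (\<rho> A ^ k * of_nat k ^ m)) \<longlonglongrightarrow> c i"
    and nn: "\<And>i. i < d \<Longrightarrow> 0 \<le> c i" and nz: "i0 < d" "c i0 \<noteq> 0"
  shows "power_method_converges_to A (ones_vec d) (vec d c)"
  unfolding power_method_converges_to_def
proof (intro conjI allI)
  have dim: "dim_row A = d" using A by auto
  show "leading_eigenvector A (vec d c)"
    unfolding leading_eigenvector_iff using leading_term_eigenvector[OF rho lim] nn nz by auto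
  show "power_method A (ones_vec d) k \<noteq> 0\<^sub>v (dim_row A)" for k
  proof
    assume "power_method A (ones_vec d) k = 0\<^sub>v (dim_row A)"
    then have "row_sum k i = 0" if "i < d" for i using that unfolding row_sum_def dim by simp
    moreover obtain i where "i < d" "\<rho> A ^ k \<le> row_sum k i" using row_sum_ge_rho_power by blast
    ultimately show False using rho by (metis not_le zero_less_power)
  qed
  have "power_method A (ones_vec d) k = vec d (row_sum k)" for k
    unfolding row_sum_def using carrier_vecD[OF power_method_carrier[of k]] by (intro eq_vecI) auto
  moreover have "vec_tendsto (\<lambda>k. normalize_vec (vec d (row_sum k))) (normalize_vec (vec d c)) sequentially"
  proof (rule normalize_vec_tendsto[where s = "\<lambda>k. inverse (\<rho> A ^ k * of_nat k ^ m)"])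
    show "(\<lambda>k. inverse (\<rho> A ^ k * of_nat k ^ m) * row_sum k i) \<longlonglongrightarrow> c i" if "i < d" for i
      using lim[OF that] by (simp add: field_simps)
    show "\<forall>\<^sub>F k in sequentially. 0 < inverse (\<rho> A ^ k * of_nat k ^ m)"
      using eventually_gt_at_top[of 0] by eventually_elim (use rho in simp)
  qed (fact nz)+
  ultimately show "vec_tendsto (\<lambda>k. normalize_vec (power_method A (ones_vec d) k)) (normalize_vec (vec d c)) sequentially"
    by simp
qed

end

theorem theorem1:
  fixes A :: "real mat" and d :: nat
  assumes "d \<ge> 1"
    and "A \<in> carrier_mat d d"
    and "nonneg_matrix A"
    and "unique_peripheral_eigenvalue A"
  shows "\<exists>v. selected_leading_eigenvector A v \<and>
    (\<rho> A > 0 \<longrightarrow>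
      (\<exists>w c. power_method_converges_to A (ones_vec d) w \<and> c \<noteq> 0 \<and> v = c \<cdot>\<^sub>v w))"
proof -
  interpret nonneg_square_matrix A d
    using assms by unfold_locales auto
  show ?thesis
  proof (cases "\<rho> A > 0")
    case True
    obtain m c where lim: "\<And>i. i < d \<Longrightarrow> (\<lambda>k. row_sum k i / (\<rho> A ^ k * of_nat k ^ m)) \<longlonglongrightarrow> c i"
      and nn: "\<And>i. i < d \<Longrightarrow> 0 \<le> c i" and "\<exists>i<d. c i \<noteq> 0"
      by (rule row_sum_leading_term[OF True assms(4)]) (rule that, blast+)
    then obtain i where i: "i < d" "c i \<noteq> 0" by blast
    have "0 < inverse (\<Sum>k. of_nat k ^ m * (\<rho> A / l) ^ k)" if "\<rho> A < l" for l
    proof -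
      have x: "norm (\<rho> A / l) < 1" "0 < \<rho> A / l" using that True by auto
      have "0 < (\<Sum>k. real k ^ m * (\<rho> A / l) ^ k)"
        using x by (intro suminf_pos2[of _ 1] summable_nat_power_times_geometric) auto
      then show ?thesis by simp
    qed
    then have "selected_leading_eigenvector A (normalize_vec (vec d c))"
      using resolvent_sum_direction[OF True lim] i
      by (intro selected_leading_eigenvector_of_resolvent_limit)
    moreover have "power_method_converges_to A (ones_vec d) (vec d c)"
      by (rule power_method_converges[OF True lim nn i])
    moreover have "inverse (euclid_norm (vec d c)) \<noteq> 0"
      using sum_squares_pos[of i d c, OF i] unfolding euclid_norm_eq by simp
    ultimately show ?thesis unfolding normalize_vec_def by blast
  next
    case False
    then have rho: "\<rho> A = 0" using rho_nonneg by simp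
    obtain m where lim: "\<And>i. i < d \<Longrightarrow> ((\<lambda>l. l ^ m * resolvent_sum l i) \<longlongrightarrow> row_sum m i) (at_right (\<rho> A))"
      and "\<exists>i<d. row_sum m i \<noteq> 0"
      by (rule nilpotent_resolvent_sum_direction[OF rho]) (rule that, blast+)
    then obtain i where i: "i < d" "row_sum m i \<noteq> 0" by blast
    have "selected_leading_eigenvector A (normalize_vec (vec d (row_sum m)))"
      by (rule selected_leading_eigenvector_of_resolvent_limit[OF lim _ i]) (simp_all add: rho)
    then show ?thesis using False by blast
  qed
qed

end
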